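(* Let $n\ge 2$, $d\ge 2$ and $p\ge 0$ be integers. If the Veronese embedding $\varphi_{\mathcal{O}_{\mathbb{P}^n}(d)}:\mathbb{P}^n\hookrightarrow\mathbb{P}^N$ satisfies property $N_p$, then one of the following holds: (i) $n=2$ and $d=2$ (with $p$ arbitrary); (ii) $n\ge 3$, $d=2$ and $p\le 5$; (iii) $n\ge 2$, $d\ge 3$ and $p\le 3d-3$.
   Context: The base field $K$ is algebraically closed of characteristic zero. $\varphi_{\mathcal{O}_{\mathbb{P}^n}(d)}:\mathbb{P}^n\hookrightarrow\mathbb{P}^N$, $N+1=\binom{n+d}{n}$, is the embedding given by the complete linear system $|\mathcal{O}_{\mathbb{P}^n}(d)|$. Let $S=\bigoplus_{k\ge 0}S^k\big(H^0(\mathbb{P}^n,\mathcal{O}_{\mathbb{P}^n}(d))\big)$ be the homogeneous coordinate ring of $\mathbb{P}^N$ and let $R=\bigoplus_{k\ge0}H^0(\mathbb{P}^n,\mathcal{O}_{\mathbb{P}^n}(kd))$, a graded $S$-module. Let $$0\to\bigoplus_j S(-j)^{\widetilde b_{rj}}\to\cdots\to\bigoplus_j S(-j)^{\widetilde b_{0j}}\to R\to 0$$ be a minimal graded free resolution of $R$, with graded Betti numbers $\widetilde b_{ij}$. For an integer $p\ge0$, the embedding satisfies property $N_p$ if $\widetilde b_{00}=1$, $\widetilde b_{0j}=0$ for $j\ne0$, and $\widetilde b_{ij}=0$ for all $j\neq i+1$ whenever $1\le i\le p$. *)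

theory Defs
  imports "HOL-Library.Poly_Mapping" "HOL-Computational_Algebra.Polynomial"
begin

section \<open>Polynomials and forms over a set of variables\<close>

text \<open>
  A monomial is its exponent vector; a polynomial is a finitely supported family of coefficients
  indexed by monomials, and its ring structure is the convolution of
  \<^theory>\<open>HOL-Library.Poly_Mapping\<close>.
\<close>

type_synonym 'v monomial = "'v \<Rightarrow>\<^sub>0 nat"
type_synonym ('v, 'k) mpoly = "'v monomial \<Rightarrow>\<^sub>0 'k"

definition mdeg :: "'v monomial \<Rightarrow> nat" where
  "mdeg t = (\<Sum>v\<in>Poly_Mapping.keys t. Poly_Mapping.lookup t v)"

definition polys :: "'v set \<Rightarrow> ('v, 'k::zero) mpoly set" where
  "polys V = {f. \<forall>t\<in>Poly_Mapping.keys f. Poly_Mapping.keys t \<subseteq> V}"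

text \<open>The degree is an integer because of the twists; there is only the zero form in negative degree.\<close>

definition forms :: "'v set \<Rightarrow> int \<Rightarrow> ('v, 'k::zero) mpoly set" where
  "forms V m = {f \<in> polys V. \<forall>t\<in>Poly_Mapping.keys f. int (mdeg t) = m}"


section \<open>Graded modules\<close>

text \<open>
  The modules below are modules over \<^term>\<open>polys V\<close>, which is standard graded (every variable
  has degree 1). A graded module is given by the scalar multiplication and by the family
  \<open>M :: int \<Rightarrow> _ set\<close> of its homogeneous pieces, which lie in a common ambient group; the underlying
  module is the (internal) direct sum of the pieces.
\<close>

definition graded_total :: "(int \<Rightarrow> 'a set) \<Rightarrow> 'a::comm_monoid_add set" where
  "graded_total M = {(\<Sum>k\<in>I. x k) | I x. finite I \<and> (\<forall>k\<in>I. x k \<in> M k)}"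

text \<open>Homomorphisms of graded modules are homogeneous of degree 0.\<close>

definition graded_hom ::
  "'v set \<Rightarrow> (('v, 'k::comm_ring_1) mpoly \<Rightarrow> 'a \<Rightarrow> 'a) \<Rightarrow> (('v, 'k) mpoly \<Rightarrow> 'b \<Rightarrow> 'b) \<Rightarrow>
   (int \<Rightarrow> 'a::ab_group_add set) \<Rightarrow> (int \<Rightarrow> 'b::ab_group_add set) \<Rightarrow> ('a \<Rightarrow> 'b) \<Rightarrow> bool" where
  "graded_hom V actA actB A B f \<longleftrightarrow>
     (\<forall>x\<in>graded_total A. \<forall>y\<in>graded_total A. f (x + y) = f x + f y) \<and>
     (\<forall>s\<in>polys V. \<forall>x\<in>graded_total A. f (actA s x) = actB s (f x)) \<and>
     (\<forall>m. f ` A m \<subseteq> B m)"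

text \<open>
  The free module \<open>\<Oplus>\<^sub>j S(-j)\<^bsup>b j\<^esup>\<close> with \<open>S = polys V\<close>: its basis elements are indexed by
  the pairs \<open>(j, l)\<close> with \<open>l < b j\<close>, the element \<open>(j, l)\<close> being of degree \<open>j\<close>.
\<close>

type_synonym ('v, 'k) free_elem = "(int \<times> nat) \<Rightarrow>\<^sub>0 ('v, 'k) mpoly"

definition free_act ::
  "('v, 'k::comm_ring_1) mpoly \<Rightarrow> ('v, 'k) free_elem \<Rightarrow> ('v, 'k) free_elem" where
  "free_act s u = Poly_Mapping.map (\<lambda>f. s * f) u"

definition graded_free ::
  "'v set \<Rightarrow> (int \<Rightarrow> nat) \<Rightarrow> int \<Rightarrow> ('v, 'k::comm_ring_1) free_elem set" where
  "graded_free V b m =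
     {u. (\<forall>(j, l)\<in>Poly_Mapping.keys u. l < b j) \<and> (\<forall>j l. Poly_Mapping.lookup u (j, l) \<in> forms V (m - j))}"

definition irrelevant_ideal :: "'v set \<Rightarrow> ('v, 'k::zero) mpoly set" where
  "irrelevant_ideal V = {f \<in> polys V. Poly_Mapping.lookup f 0 = 0}"

text \<open>
  \<open>\<epsilon> : F\<^sub>0 \<rightarrow> M\<close> and \<open>\<delta> i : F\<^bsub>i+1\<^esub> \<rightarrow> F\<^sub>i\<close>, where \<open>F\<^sub>i = \<Oplus>\<^sub>j S(-j)\<^bsup>b i j\<^esup>\<close>, form a
  minimal free resolution of \<open>M\<close>, of finite length and with all \<open>F\<^sub>i\<close> finitely generated. Minimality
  means \<open>\<delta> i (F\<^bsub>i+1\<^esub>) \<subseteq> \<mm> F\<^sub>i\<close> for the irrelevant ideal \<open>\<mm>\<close>.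
\<close>

definition minimal_graded_free_resolution ::
  "'v set \<Rightarrow> (('v, 'k::comm_ring_1) mpoly \<Rightarrow> 'a \<Rightarrow> 'a) \<Rightarrow> (int \<Rightarrow> 'a::ab_group_add set) \<Rightarrow>
   (nat \<Rightarrow> int \<Rightarrow> nat) \<Rightarrow> (('v, 'k) free_elem \<Rightarrow> 'a) \<Rightarrow>
   (nat \<Rightarrow> ('v, 'k) free_elem \<Rightarrow> ('v, 'k) free_elem) \<Rightarrow> bool" where
  "minimal_graded_free_resolution V act M b \<epsilon> \<delta> \<longleftrightarrow>
     (let F = (\<lambda>i. graded_free V (b i)) in
      (\<forall>i. finite {j. b i j \<noteq> 0}) \<and>
      (\<exists>r. \<forall>i>r. \<forall>j. b i j = 0) \<and>
      graded_hom V free_act act (F 0) M \<epsilon> \<and>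
      (\<forall>i. graded_hom V free_act free_act (F (Suc i)) (F i) (\<delta> i)) \<and>
      \<epsilon> ` graded_total (F 0) = graded_total M \<and>
      \<delta> 0 ` graded_total (F 1) = {u \<in> graded_total (F 0). \<epsilon> u = 0} \<and>
      (\<forall>i. \<delta> (Suc i) ` graded_total (F (Suc (Suc i))) =
             {u \<in> graded_total (F (Suc i)). \<delta> i u = 0}) \<and>
      (\<forall>i. \<forall>u\<in>graded_total (F (Suc i)). \<forall>e. Poly_Mapping.lookup (\<delta> i u) e \<in> irrelevant_ideal V))"


section \<open>The Veronese embedding\<close>

text \<open>The global sections of \<open>O(m)\<close> on \<open>\<P>\<^sup>n\<close> are the forms of degree \<open>m\<close> in \<open>x\<^sub>0, \<dots>, x\<^sub>n\<close>.\<close>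

definition H0 :: "nat \<Rightarrow> int \<Rightarrow> (nat, 'k::zero) mpoly set" where
  "H0 n m = forms {..n} m"

text \<open>
  The monomials of degree \<open>d\<close> are a basis of \<open>H0 n d\<close>. They are the variables \<open>y\<^sub>t\<close> of the homogeneous
  coordinate ring \<open>S = Sym (H0 n d)\<close> of \<open>\<P>\<^sup>N\<close>, which is \<open>polys (veronese_vars n d)\<close>.
\<close>

definition veronese_vars :: "nat \<Rightarrow> nat \<Rightarrow> nat monomial set" where
  "veronese_vars n d = {t. Poly_Mapping.keys t \<subseteq> {..n} \<and> mdeg t = d}"

text \<open>The multiplication of sections: the ring homomorphism over \<open>K\<close> with \<open>y\<^sub>t \<mapsto> x\<^sup>t\<close>.\<close>

definition veronese_hom :: "(nat monomial, 'k::comm_ring_1) mpoly \<Rightarrow> (nat, 'k) mpoly" where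
  "veronese_hom f =
     (\<Sum>a\<in>Poly_Mapping.keys f. Poly_Mapping.single 0 (Poly_Mapping.lookup f a) *
        (\<Prod>t\<in>Poly_Mapping.keys a. Poly_Mapping.single t 1 ^ Poly_Mapping.lookup a t))"

text \<open>The graded \<open>S\<close>-module \<open>R = \<Oplus>\<^sub>k H0 n (k d)\<close>; the pieces of negative degree vanish if \<open>d > 0\<close>.\<close>

definition veronese_module :: "nat \<Rightarrow> nat \<Rightarrow> int \<Rightarrow> (nat, 'k::comm_ring_1) mpoly set" where
  "veronese_module n d k = H0 n (k * int d)"

definition veronese_act ::
  "(nat monomial, 'k::comm_ring_1) mpoly \<Rightarrow> (nat, 'k) mpoly \<Rightarrow> (nat, 'k) mpoly" where
  "veronese_act s r = veronese_hom s * r"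

text \<open>
  Property \<open>N\<^sub>p\<close>. The graded Betti numbers \<open>b i j\<close> do not depend on the choice of the
  minimal resolution, so that it may be chosen arbitrarily.
\<close>

definition veronese_satisfies_N :: "'k::field itself \<Rightarrow> nat \<Rightarrow> nat \<Rightarrow> nat \<Rightarrow> bool" where
  "veronese_satisfies_N _ n d p \<longleftrightarrow>
     (\<exists>b (\<epsilon> :: (nat monomial, 'k) free_elem \<Rightarrow> (nat, 'k) mpoly) \<delta>.
        minimal_graded_free_resolution (veronese_vars n d) veronese_act (veronese_module n d) b \<epsilon> \<delta> \<and>
        b 0 0 = 1 \<and> (\<forall>j. j \<noteq> 0 \<longrightarrow> b 0 j = 0) \<and>
        (\<forall>i. 1 \<le> i \<and> i \<le> p \<longrightarrow> (\<forall>j. j \<noteq> int i + 1 \<longrightarrow> b i j = 0)))"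

end

theory Submission
  imports Defs
begin

text \<open>
  Let \<open>f\<close> be a monomial of degree \<open>2d\<close> with all exponents less than \<open>d\<close>, and let \<open>m\<^sub>1, \<dots>, m\<^sub>p\<close> be
  its divisors of degree \<open>d\<close>. If each \<open>m\<^sub>k\<close> is divisible by a variable with exponent \<open>d - 1\<close> in \<open>f\<close>,
  then \<open>m\<^sub>1 \<and> \<dots> \<and> m\<^sub>p \<otimes> f\<close> is a Koszul cycle modulo the powers \<open>x\<^sub>v\<^sup>d\<close>, and it lifts to an explicit Koszul
  cycle with coefficients in \<open>R\<close> (this is the method of Ein, Erman and Lazarsfeld). It is not a
  boundary, because a boundary involves \<open>m\<^sub>1 \<and> \<dots> \<and> m\<^sub>p\<close> only with multiples of monomials other than the
  \<open>m\<^sub>k\<close>. So the resolution has a generator of degree \<open>p + 2\<close> in homological degree \<open>p\<close>, which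
  contradicts \<open>N\<^sub>p\<close>.
\<close>

section \<open>Koszul chains\<close>

text \<open>
  A chain \<open>c\<close> stands for the element \<open>\<Sum>\<^sub>T T \<otimes> c T\<close>, where a finite set \<open>T\<close> is identified with the
  exterior product of its elements in increasing order.
\<close>

definition koszul_sign :: "'v::linorder \<Rightarrow> 'v set \<Rightarrow> 'r::comm_ring_1" where
  "koszul_sign g T = (-1) ^ card {h\<in>T. h < g}"

text \<open>The Koszul differential read on coefficients: the coefficient at \<open>T\<close>
  collects what remains of each \<open>insert g T\<close> after \<open>g\<close> is contracted to
  \<open>y g\<close>. The action is a parameter, so that one formula serves the ring, the free
  modules and the Veronese module.\<close>

definition koszul_bd ::
  "'v::linorder set \<Rightarrow> ('r::comm_ring_1 \<Rightarrow> 'a \<Rightarrow> 'a::ab_group_add) \<Rightarrow> ('v \<Rightarrow> 'r) \<Rightarrow>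
   ('v set \<Rightarrow> 'a) \<Rightarrow> 'v set \<Rightarrow> 'a" where
  "koszul_bd V act y c T = (\<Sum>g\<in>V - T. act (koszul_sign g T * y g) (c (insert g T)))"

text \<open>Left exterior multiplication by \<open>v\<close>; the sign moves \<open>v\<close> to its
  place in the increasing order.\<close>

definition ext_mult :: "'v::linorder \<Rightarrow> ('v set \<Rightarrow> 'r::comm_ring_1) \<Rightarrow> 'v set \<Rightarrow> 'r" where
  "ext_mult v c T = (if v \<in> T then koszul_sign v (T - {v}) * c (T - {v}) else 0)"

lemma koszul_sign_insert:
  assumes "finite T" "h \<notin> T"
  shows "koszul_sign g (insert h T) = (if h < g then - koszul_sign g T else koszul_sign g T)"
proof (cases "h < g")
  case True
  then have "{x \<in> insert h T. x < g} = insert h {x\<in>T. x < g}" by auto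
  then show ?thesis using True assms by (simp add: koszul_sign_def)
next
  case False
  then have "{x \<in> insert h T. x < g} = {x\<in>T. x < g}" by auto
  then show ?thesis using False by (simp add: koszul_sign_def)
qed

lemma koszul_sign_square [simp]:
  "koszul_sign g T * koszul_sign g T = 1" "koszul_sign g T * (koszul_sign g T * a) = a"
proof -
  show *: "koszul_sign g T * koszul_sign g T = 1"
    by (simp add: koszul_sign_def flip: power_mult_distrib)
  show "koszul_sign g T * (koszul_sign g T * a) = a"
    unfolding mult.assoc[symmetric] * by simp
qed

lemma koszul_sign_swap:
  assumes "finite T" "g \<notin> T" "h \<notin> T" "g \<noteq> h"
  shows "koszul_sign g (insert h T) * koszul_sign h T =
         - (koszul_sign h (insert g T) * koszul_sign g T)"
  using assms by (auto simp: koszul_sign_insert mult.commute)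

text \<open>Exchanging the two summations would only show that twice the sum vanishes, which is too
  weak in a group with 2-torsion. Induction on \<open>A\<close> cancels the new row against the new
  column instead.\<close>

lemma sum_antisymmetric_eq_0:
  fixes a :: "'b \<Rightarrow> 'b \<Rightarrow> 'a::ab_group_add"
  assumes "finite A" "\<And>g h. g \<in> A \<Longrightarrow> h \<in> A \<Longrightarrow> g \<noteq> h \<Longrightarrow> a g h = - a h g"
  shows "(\<Sum>g\<in>A. \<Sum>h\<in>A - {g}. a g h) = 0"
  using assms
proof (induction A rule: finite_induct)
  case (insert x A)
  have prems: "a g h = - a h g" if "g \<in> insert x A" "h \<in> insert x A" "g \<noteq> h" for g h
    using that by (rule insert.prems)
  have 1: "(\<Sum>g\<in>A. \<Sum>h\<in>A - {g}. a g h) = 0"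
  proof (rule insert.IH)
    fix g h assume "g \<in> A" "h \<in> A" "g \<noteq> h"
    then show "a g h = - a h g" using prems[of g h] by blast
  qed
  have "a x h = - a h x" if "h \<in> A" for h
    using prems[of x h] that insert.hyps by blast
  then have 2: "(\<Sum>h\<in>A. a x h) = - (\<Sum>g\<in>A. a g x)"
    unfolding sum_negf[symmetric] by (rule sum.cong[OF refl])
  have "(\<Sum>h\<in>insert x A - {g}. a g h) = a g x + (\<Sum>h\<in>A - {g}. a g h)" if "g \<in> A" for g
  proof -
    have "insert x A - {g} = insert x (A - {g})" using insert.hyps that by auto
    then show ?thesis using insert.hyps by simp
  qed
  moreover have "insert x A - {x} = A" using insert.hyps by auto
  ultimately have "(\<Sum>g\<in>insert x A. \<Sum>h\<in>insert x A - {g}. a g h) =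
      (\<Sum>h\<in>A. a x h) + ((\<Sum>g\<in>A. a g x) + (\<Sum>g\<in>A. \<Sum>h\<in>A - {g}. a g h))"
    using insert.hyps by (simp add: sum.distrib)
  then show ?case unfolding 1 2 by simp
qed simp

text \<open>Contracting \<open>g\<close> and \<open>h\<close> in the two possible orders gives the
  same term with opposite signs.\<close>

lemma koszul_bd_bd:
  assumes "finite V" "T \<subseteq> V"
  shows "koszul_bd V (*) y (koszul_bd V (*) y c) T = 0"
proof -
  have fin: "finite T" using assms finite_subset by blast
  define a where "a g h = koszul_sign g T * y g *
      (koszul_sign h (insert g T) * y h * c (insert h (insert g T)))" for g h
  have "koszul_bd V (*) y (koszul_bd V (*) y c) T = (\<Sum>g\<in>V - T. \<Sum>h\<in>V - T - {g}. a g h)"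
    unfolding koszul_bd_def a_def
  proof (rule sum.cong[OF refl])
    fix g assume "g \<in> V - T"
    have "V - insert g T = V - T - {g}" by blast
    then show "koszul_sign g T * y g *
        (\<Sum>h\<in>V - insert g T. koszul_sign h (insert g T) * y h * c (insert h (insert g T))) =
      (\<Sum>h\<in>V - T - {g}. koszul_sign g T * y g *
        (koszul_sign h (insert g T) * y h * c (insert h (insert g T))))"
      by (simp add: sum_distrib_left)
  qed
  also have "\<dots> = 0"
  proof (rule sum_antisymmetric_eq_0)
    fix g h assume gh: "g \<in> V - T" "h \<in> V - T" "g \<noteq> h"
    have "a g h = (koszul_sign h (insert g T) * koszul_sign g T) * (y g * y h * c (insert h (insert g T)))"
      by (simp add: a_def mult_ac)
    also have "koszul_sign h (insert g T) * koszul_sign g T = - (koszul_sign g (insert h T) * koszul_sign h T)"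
      by (rule koszul_sign_swap) (use gh fin in auto)
    also have "\<dots> * (y g * y h * c (insert h (insert g T))) = - a h g" by (simp add: a_def mult_ac insert_commute)
    finally show "a g h = - a h g" .
  qed (use assms in simp)
  finally show ?thesis .
qed

text \<open>Contraction is an antiderivation of the exterior algebra. This is the algebraic source
  both of the homotopy below and of the vanishing boundary of \<open>wedge\<close>.\<close>

lemma koszul_bd_ext_mult:
  assumes "finite V" "T \<subseteq> V" "v \<in> V"
  shows "koszul_bd V (*) y (ext_mult v c) T + ext_mult v (koszul_bd V (*) y c) T = y v * c T"
proof (cases "v \<in> T")
  case False
  \<comment> \<open>Since \<open>T\<close> does not contain \<open>v\<close>, the set
    \<open>insert g T\<close> contains \<open>v\<close> only for \<open>g = v\<close>.\<close>
  have "koszul_bd V (*) y (ext_mult v c) T =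
      (\<Sum>g\<in>V - T. if g = v then y v * c T else 0)"
    unfolding koszul_bd_def ext_mult_def
    by (rule sum.cong) (use False in \<open>auto simp: insert_Diff_if mult_ac\<close>)
  also have "\<dots> = y v * c T" using assms False by simp
  finally show ?thesis using False by (simp add: ext_mult_def)
next
  case True
  define U where "U = T - {v}"
  have U: "T = insert v U" "v \<notin> U" "finite U"
    using True assms finite_subset[of T V] by (auto simp: U_def)
  define a where "a g = koszul_sign g T * y g * (koszul_sign v (insert g U) * c (insert g U))" for g
  have "koszul_bd V (*) y (ext_mult v c) T = (\<Sum>g\<in>V - T. a g)"
    unfolding koszul_bd_def ext_mult_def a_def
  proof (rule sum.cong[OF refl])
    fix g assume "g \<in> V - T"
    then have "insert g T - {v} = insert g U" using U by auto
    then show "koszul_sign g T * y g *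
        (if v \<in> insert g T then koszul_sign v (insert g T - {v}) * c (insert g T - {v}) else 0) =
      koszul_sign g T * y g * (koszul_sign v (insert g U) * c (insert g U))"
      using True by simp
  qed
  moreover have "ext_mult v (koszul_bd V (*) y c) T =
      y v * c T + (\<Sum>g\<in>V - T. koszul_sign v U * (koszul_sign g U * y g * c (insert g U)))"
  proof -
    \<comment> \<open>The term for \<open>g = v\<close> is the diagonal one and yields
      \<open>y v * c T\<close>; all others cancel in the next block, because \<open>g\<close> and
      \<open>v\<close> anticommute.\<close>
    have "V - U = insert v (V - T)" "v \<notin> V - T" using U assms by auto
    then have "koszul_bd V (*) y c U =
        koszul_sign v U * y v * c T + (\<Sum>g\<in>V - T. koszul_sign g U * y g * c (insert g U))"
      using assms by (simp add: koszul_bd_def flip: U(1))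
    moreover have "ext_mult v (koszul_bd V (*) y c) T = koszul_sign v U * koszul_bd V (*) y c U"
      using True by (simp add: ext_mult_def U_def)
    ultimately show ?thesis
      by (simp add: distrib_left sum_distrib_left mult.assoc)
  qed
  moreover have "(\<Sum>g\<in>V - T. a g) +
      (\<Sum>g\<in>V - T. koszul_sign v U * (koszul_sign g U * y g * c (insert g U))) = 0"
    unfolding sum.distrib[symmetric]
  proof (rule sum.neutral, intro ballI)
    fix g assume g: "g \<in> V - T"
    have "a g = (koszul_sign g (insert v U) * koszul_sign v (insert g U)) * (y g * c (insert g U))"
      by (simp add: a_def U mult_ac)
    also have "\<dots> = - (koszul_sign v U * koszul_sign g U) * (y g * c (insert g U))"
      using U g by (auto simp: koszul_sign_insert)
    finally show "a g + koszul_sign v U * (koszul_sign g U * y g * c (insert g U)) = 0"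
      by (simp add: mult_ac)
  qed
  ultimately show ?thesis by (simp add: algebra_simps)
qed

section \<open>Polynomials\<close>

definition var :: "'v \<Rightarrow> ('v, 'k::zero_neq_one) mpoly" where
  "var g = Poly_Mapping.single (Poly_Mapping.single g 1) 1"

lemma lookup_single_mult_add:
  fixes f :: "'m::cancel_comm_monoid_add \<Rightarrow>\<^sub>0 'k::semiring_1"
  shows "Poly_Mapping.lookup (Poly_Mapping.single s c * f) (s + u) = c * Poly_Mapping.lookup f u"
  by (simp add: lookup_mult lookup_single when_mult)

lemma lookup_single_mult_eq_0:
  fixes f :: "'m::cancel_comm_monoid_add \<Rightarrow>\<^sub>0 'k::semiring_1"
  assumes "\<And>u. t \<noteq> s + u"
  shows "Poly_Mapping.lookup (Poly_Mapping.single s c * f) t = 0"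
  using keys_mult[of "Poly_Mapping.single s c" f] assms
  by (cases "c = 0") (auto simp flip: not_in_keys_iff_lookup_eq_zero)

section \<open>Degrees of monomials and closure properties of forms\<close>

lemma mdeg_superset:
  assumes "finite A" "Poly_Mapping.keys t \<subseteq> A"
  shows "mdeg t = (\<Sum>v\<in>A. Poly_Mapping.lookup t v)"
  unfolding mdeg_def using assms by (intro sum.mono_neutral_left) (auto simp: in_keys_iff)

lemma mdeg_add [simp]: "mdeg (s + t) = mdeg s + mdeg t"
  using mdeg_superset[of "Poly_Mapping.keys s \<union> Poly_Mapping.keys t"]
  by (simp add: keys_add lookup_add sum.distrib)

lemma mdeg_single [simp]: "mdeg (Poly_Mapping.single v a) = a"
  by (simp add: mdeg_def)

lemma mdeg_zero [simp]: "mdeg 0 = 0"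
  by (simp add: mdeg_def)

lemma mdeg_sum: "mdeg (sum t A) = (\<Sum>a\<in>A. mdeg (t a))"
  by (induction A rule: infinite_finite_induct) auto

lemma keys_add_nat: "Poly_Mapping.keys (s + t) = Poly_Mapping.keys s \<union> Poly_Mapping.keys (t :: 'v monomial)"
  by (auto simp: in_keys_iff lookup_add)

lemma formsD:
  assumes "f \<in> forms V m" "Poly_Mapping.lookup f t \<noteq> 0"
  shows "Poly_Mapping.keys t \<subseteq> V" "int (mdeg t) = m"
  using assms by (auto simp: forms_def polys_def in_keys_iff)

lemma formsI:
  assumes "\<And>t. Poly_Mapping.lookup f t \<noteq> 0 \<Longrightarrow> Poly_Mapping.keys t \<subseteq> V \<and> int (mdeg t) = m"
  shows "f \<in> forms V m"
  using assms by (auto simp: forms_def polys_def in_keys_iff)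

lemma forms_0 [simp]: "0 \<in> forms V m"
  by (rule formsI) simp

lemma forms_add:
  assumes "f \<in> forms V m" "g \<in> forms V m"
  shows "f + g \<in> forms V m"
proof (rule formsI)
  fix t assume "Poly_Mapping.lookup (f + g) t \<noteq> 0"
  then have "Poly_Mapping.lookup f t \<noteq> 0 \<or> Poly_Mapping.lookup g t \<noteq> 0"
    by (auto simp: lookup_add)
  then show "Poly_Mapping.keys t \<subseteq> V \<and> int (mdeg t) = m" using assms formsD by blast
qed

lemma forms_uminus: "f \<in> forms V m \<Longrightarrow> - f \<in> forms V m"
  for f :: "('v, 'k::ab_group_add) mpoly"
  by (simp add: forms_def polys_def)

lemma forms_sum: "(\<And>a. a \<in> A \<Longrightarrow> f a \<in> forms V m) \<Longrightarrow> sum f A \<in> forms V m"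
  by (induction A rule: infinite_finite_induct) (auto intro: forms_add)

lemma forms_mult:
  fixes f g :: "('v, 'k::comm_ring_1) mpoly"
  assumes "f \<in> forms V m" "g \<in> forms V m'"
  shows "f * g \<in> forms V (m + m')"
proof (rule formsI)
  fix t assume "Poly_Mapping.lookup (f * g) t \<noteq> 0"
  then have "t \<in> Poly_Mapping.keys (f * g)" by (simp add: in_keys_iff)
  then obtain a b where "t = a + b" "Poly_Mapping.lookup f a \<noteq> 0" "Poly_Mapping.lookup g b \<noteq> 0"
    using keys_mult[of f g] by (auto simp: in_keys_iff)
  then show "Poly_Mapping.keys t \<subseteq> V \<and> int (mdeg t) = m + m'"
    using formsD[OF assms(1)] formsD[OF assms(2)] by (auto simp: keys_add_nat)
qed

lemma forms_polys: "f \<in> forms V m \<Longrightarrow> f \<in> polys V"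
  by (simp add: forms_def)

lemma koszul_sign_cases:
  obtains "(koszul_sign g T :: 'r::comm_ring_1) = 1" | "(koszul_sign g T :: 'r) = -1"
  unfolding koszul_sign_def by (metis neg_one_even_power neg_one_odd_power)

lemma koszul_sign_mult_forms:
  fixes f :: "('v, 'k::comm_ring_1) mpoly"
  assumes "f \<in> forms V m"
  shows "koszul_sign g T * f \<in> forms V m"
proof (cases g T rule: koszul_sign_cases[where 'r="('v, 'k) mpoly"])
  case 1
  show ?thesis unfolding 1 using assms by simp
next
  case 2
  show ?thesis unfolding 2 using forms_uminus[OF assms] by simp
qed

lemma koszul_sign_var_forms:
  assumes "g \<in> V"
  shows "(koszul_sign g T * var g :: ('v::linorder, 'k::comm_ring_1) mpoly) \<in> forms V 1"
proof (rule koszul_sign_mult_forms, rule formsI)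
  fix t assume "Poly_Mapping.lookup (var g :: ('v, 'k) mpoly) t \<noteq> 0"
  then have "t = Poly_Mapping.single g 1"
    unfolding var_def lookup_single by (metis when_neq_zero)
  then show "Poly_Mapping.keys t \<subseteq> V \<and> int (mdeg t) = 1" using assms by simp
qed

section \<open>Formal partial derivatives and the Euler identity\<close>

definition pderiv_var :: "'v \<Rightarrow> ('v, 'k::comm_ring_1) mpoly \<Rightarrow> ('v, 'k) mpoly" where
  "pderiv_var v f = Abs_poly_mapping (\<lambda>t. of_nat (Suc (Poly_Mapping.lookup t v)) *
     Poly_Mapping.lookup f (Poly_Mapping.single v 1 + t))"

lemma lookup_pderiv_var:
  "Poly_Mapping.lookup (pderiv_var v f) t = of_nat (Suc (Poly_Mapping.lookup t v)) *
     Poly_Mapping.lookup f (Poly_Mapping.single v 1 + t)"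
proof -
  have "{t. of_nat (Suc (Poly_Mapping.lookup t v)) *
      Poly_Mapping.lookup f (Poly_Mapping.single v 1 + t) \<noteq> 0}
    \<subseteq> (\<lambda>t. Poly_Mapping.single v 1 + t) -` Poly_Mapping.keys f"
    by (auto simp: in_keys_iff)
  \<comment> \<open>Finite support is inherited from \<open>f\<close>, because adding a fixed
    monomial is injective.\<close>
  moreover have "finite ((\<lambda>t. Poly_Mapping.single v 1 + t) -` Poly_Mapping.keys f)"
    by (rule finite_vimageI) (auto simp: inj_on_def)
  ultimately show ?thesis
    unfolding pderiv_var_def by (subst lookup_Abs_poly_mapping) (auto dest: finite_subset)
qed

lemma pderiv_var_add: "pderiv_var v (f + g) = pderiv_var v f + pderiv_var v g"
  by (rule poly_mapping_eqI) (simp add: lookup_pderiv_var lookup_add distrib_left)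

lemma pderiv_var_0 [simp]: "pderiv_var v 0 = 0"
  by (rule poly_mapping_eqI) (simp add: lookup_pderiv_var)

lemma pderiv_var_uminus: "pderiv_var v (- f) = - pderiv_var v f"
  by (rule poly_mapping_eqI) (simp add: lookup_pderiv_var)

lemma pderiv_var_sum: "pderiv_var v (sum f A) = (\<Sum>a\<in>A. pderiv_var v (f a))"
  by (induction A rule: infinite_finite_induct) (auto simp: pderiv_var_add)

lemma pderiv_var_koszul_sign_mult:
  fixes f :: "('v, 'k::comm_ring_1) mpoly"
  shows "pderiv_var v (koszul_sign g T * f) = koszul_sign g T * pderiv_var v f"
proof (cases g T rule: koszul_sign_cases[where 'r="('v, 'k) mpoly"])
  case 1
  show ?thesis unfolding 1 by simp
next
  case 2
  show ?thesis unfolding 2 by (simp add: pderiv_var_uminus)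
qed

lemma monomial_split:
  fixes t :: "'v monomial"
  obtains u where "t = Poly_Mapping.single g 1 + u" | "Poly_Mapping.lookup t g = 0"
proof (cases "Poly_Mapping.lookup t g = 0")
  case False
  then have "t = Poly_Mapping.single g 1 + (t - Poly_Mapping.single g 1)"
    by (intro poly_mapping_eqI) (auto simp: lookup_add lookup_minus lookup_single when_def)
  then show ?thesis using that by blast
qed (use that in blast)

lemma lookup_var_mult_eq_0:
  assumes "Poly_Mapping.lookup t g = 0"
  shows "Poly_Mapping.lookup (var g * f :: ('v, 'k::comm_ring_1) mpoly) t = 0"
  unfolding var_def
proof (rule lookup_single_mult_eq_0)
  fix u show "t \<noteq> Poly_Mapping.single g 1 + u"
    using assms by (auto simp: lookup_add)
qed

lemma lookup_var_mult_add:
  "Poly_Mapping.lookup (var g * f :: ('v, 'k::comm_ring_1) mpoly) (Poly_Mapping.single g 1 + u) =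
   Poly_Mapping.lookup f u"
  by (simp add: var_def lookup_single_mult_add)

text \<open>The Leibniz rule for the products that occur in the Koszul differential. It is checked
  on monomials, according to whether \<open>g\<close> divides \<open>t\<close>.\<close>

lemma pderiv_var_var_mult:
  "pderiv_var v (var g * f) = var g * pderiv_var v f + (if g = v then f else 0)"
  for f :: "('v, 'k::comm_ring_1) mpoly"
proof (rule poly_mapping_eqI)
  fix t
  show "Poly_Mapping.lookup (pderiv_var v (var g * f)) t =
      Poly_Mapping.lookup (var g * pderiv_var v f + (if g = v then f else 0)) t"
  proof (rule monomial_split[of t g])
    fix u assume t: "t = Poly_Mapping.single g 1 + u"
    have *: "Poly_Mapping.single v 1 + t = Poly_Mapping.single g 1 + (Poly_Mapping.single v 1 + u)"
      by (simp add: t add_ac)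
    have "Poly_Mapping.lookup (pderiv_var v (var g * f)) t =
        of_nat (Suc (Poly_Mapping.lookup t v)) * Poly_Mapping.lookup f (Poly_Mapping.single v 1 + u)"
      unfolding lookup_pderiv_var * lookup_var_mult_add ..
    moreover have "Poly_Mapping.lookup (var g * pderiv_var v f) t =
        of_nat (Suc (Poly_Mapping.lookup u v)) * Poly_Mapping.lookup f (Poly_Mapping.single v 1 + u)"
      unfolding t lookup_var_mult_add lookup_pderiv_var ..
    ultimately show ?thesis
      by (auto simp: lookup_add t lookup_single when_def algebra_simps)
  next
    assume t: "Poly_Mapping.lookup t g = 0"
    show ?thesis
    proof (cases "g = v")
      case True
      show ?thesis unfolding True lookup_pderiv_var lookup_var_mult_add
        using t lookup_var_mult_eq_0[OF t, of "pderiv_var v f"] by (simp add: True lookup_add)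
    next
      case False
      then have "Poly_Mapping.lookup (Poly_Mapping.single v 1 + t) g = 0"
        using t by (simp add: lookup_add lookup_single)
      then show ?thesis using False
        by (simp add: lookup_pderiv_var lookup_var_mult_eq_0[OF t] lookup_var_mult_eq_0)
    qed
  qed
qed

text \<open>Every monomial is an eigenvector of each operator \<open>var v * pderiv_var v\<close>,
  with its exponent at \<open>v\<close> as eigenvalue; the exponents add up to the degree.\<close>

lemma euler_identity:
  fixes f :: "('v, 'k::comm_ring_1) mpoly"
  assumes "finite V" "f \<in> forms V m"
  shows "(\<Sum>v\<in>V. var v * pderiv_var v f) = of_int m * f"
proof (rule poly_mapping_eqI)
  fix t
  have "Poly_Mapping.lookup (var v * pderiv_var v f) t =
      of_nat (Poly_Mapping.lookup t v) * Poly_Mapping.lookup f t" for v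
  proof (rule monomial_split[of t v])
    fix u assume t: "t = Poly_Mapping.single v 1 + u"
    show ?thesis unfolding t lookup_var_mult_add lookup_pderiv_var by (simp add: lookup_add)
  qed (simp add: lookup_var_mult_eq_0)
  then have "Poly_Mapping.lookup (\<Sum>v\<in>V. var v * pderiv_var v f) t =
      of_nat (\<Sum>v\<in>V. Poly_Mapping.lookup t v) * Poly_Mapping.lookup f t"
    by (simp add: lookup_sum sum_distrib_right)
  also have "\<dots> = of_int m * Poly_Mapping.lookup f t"
  proof (cases "Poly_Mapping.lookup f t = 0")
    case False
    then have "(\<Sum>v\<in>V. Poly_Mapping.lookup t v) = mdeg t" "int (mdeg t) = m"
      using formsD[OF assms(2)] mdeg_superset[OF assms(1)] by auto
    then show ?thesis by (metis of_int_of_nat_eq)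
  qed simp
  also have "\<dots> = Poly_Mapping.lookup (of_int m * f) t"
  proof -
    have "of_int m * f = Poly_Mapping.single 0 (of_int m) * f" by simp
    then show ?thesis using lookup_single_mult_add[of 0 "of_int m" f t] by simp
  qed
  finally show "Poly_Mapping.lookup (\<Sum>v\<in>V. var v * pderiv_var v f) t =
      Poly_Mapping.lookup (of_int m * f) t" .
qed

lemma pderiv_var_forms:
  assumes "f \<in> forms V m"
  shows "pderiv_var v f \<in> forms V (m - 1)"
proof (rule formsI)
  fix t assume "Poly_Mapping.lookup (pderiv_var v f) t \<noteq> 0"
  then have "Poly_Mapping.lookup f (Poly_Mapping.single v 1 + t) \<noteq> 0"
    by (auto simp: lookup_pderiv_var)
  then show "Poly_Mapping.keys t \<subseteq> V \<and> int (mdeg t) = m - 1"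
    using formsD[OF assms, of "Poly_Mapping.single v 1 + t"] by (auto simp: keys_add_nat)
qed

section \<open>Exactness of the Koszul complex\<close>

lemma koszul_bd_cong:
  assumes "\<And>g. g \<in> V - T \<Longrightarrow> c (insert g T) = c' (insert g T)"
  shows "koszul_bd V act y c T = koszul_bd V act y c' T"
  unfolding koszul_bd_def using assms by (intro sum.cong) auto

lemma koszul_bd_sum:
  "koszul_bd V (*) y (\<lambda>T. \<Sum>i\<in>I. c i T) T = (\<Sum>i\<in>I. koszul_bd V (*) y (c i) T)"
  unfolding koszul_bd_def sum_distrib_left by (rule sum.swap)

lemma koszul_bd_scale:
  "koszul_bd V (*) y (\<lambda>T. a * c T) T = a * koszul_bd V (*) y c T"
  unfolding koszul_bd_def sum_distrib_left by (simp add: mult_ac)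

text \<open>By the Leibniz rule, differentiation commutes with the boundary except for the one term
  in which the contracted element is \<open>v\<close> itself.\<close>

lemma pderiv_var_koszul_bd:
  fixes c :: "'v::linorder set \<Rightarrow> ('v, 'k::comm_ring_1) mpoly"
  assumes "finite V" "v \<in> V - T"
  shows "pderiv_var v (koszul_bd V (*) var c T) =
    koszul_bd V (*) var (\<lambda>T. pderiv_var v (c T)) T + koszul_sign v T * c (insert v T)"
proof -
  have "(\<Sum>g\<in>V - T. if g = v then koszul_sign v T * c (insert v T) else 0) =
      koszul_sign v T * c (insert v T)"
    using assms by simp
  moreover have "koszul_sign g T * (if g = v then c (insert g T) else 0) =
      (if g = v then koszul_sign v T * c (insert v T) else 0)" for g
    by simp
  ultimately show ?thesis
    by (simp add: koszul_bd_def pderiv_var_sum mult.assoc pderiv_var_koszul_sign_mult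
        pderiv_var_var_mult distrib_left sum.distrib)
qed

text \<open>
  The exterior derivative \<open>h = \<Sum>\<^sub>v v \<and> \<partial>/\<partial>v\<close> is a homotopy: \<open>\<partial> h + h \<partial>\<close> is multiplication by the
  total degree \<open>m + q\<close>.
\<close>

lemma koszul_exact_forms:
  fixes c :: "'v::linorder set \<Rightarrow> ('v, 'k::field_char_0) mpoly"
  assumes V: "finite V"
    and c: "\<And>T. T \<subseteq> V \<Longrightarrow> card T = q \<Longrightarrow> c T \<in> forms V m"
    and bd: "\<And>T. T \<subseteq> V \<Longrightarrow> Suc (card T) = q \<Longrightarrow> koszul_bd V (*) var c T = 0"
    and deg: "m + int q \<noteq> 0"
  shows "\<exists>e. (\<forall>T. T \<subseteq> V \<longrightarrow> card T = Suc q \<longrightarrow> e T \<in> forms V (m - 1)) \<and>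
             (\<forall>T. T \<subseteq> V \<longrightarrow> card T = q \<longrightarrow> koszul_bd V (*) var e T = c T)"
proof -
  define h where "h T = (\<Sum>v\<in>V. ext_mult v (\<lambda>T. pderiv_var v (c T)) T)" for T
  have h: "koszul_bd V (*) var h T = of_int (m + int q) * c T" if T: "T \<subseteq> V" "card T = q" for T
  proof -
    have *: "koszul_bd V (*) var (ext_mult v (\<lambda>T. pderiv_var v (c T))) T =
        var v * pderiv_var v (c T) + (if v \<in> T then c T else 0)" if "v \<in> V" for v
    proof -
      \<comment> \<open>Differentiating the cycle condition at \<open>T - {v}\<close> with respect
        to \<open>v\<close> expresses the boundary of the derivatives there by \<open>c T\<close>,
        up to a sign that \<open>ext_mult\<close> removes.\<close>
      have "ext_mult v (koszul_bd V (*) var (\<lambda>T. pderiv_var v (c T))) T = (if v \<in> T then - c T else 0)"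
      proof (cases "v \<in> T")
        case True
        define U where "U = T - {v}"
        have U: "insert v U = T" "v \<in> V - U" "U \<subseteq> V" "Suc (card U) = q"
          using True T V card_Suc_Diff1[of T v] finite_subset[of T V] by (auto simp: U_def)
        have "koszul_bd V (*) var (\<lambda>T. pderiv_var v (c T)) U = - (koszul_sign v U * c T)"
          using pderiv_var_koszul_bd[OF V U(2), of c] bd[OF U(3,4)] U(1)
          by (simp add: eq_neg_iff_add_eq_0)
        then show ?thesis using True by (simp add: ext_mult_def flip: U_def)
      qed (simp add: ext_mult_def)
      then show ?thesis
        using koszul_bd_ext_mult[OF V T(1) that, of var "\<lambda>T. pderiv_var v (c T)"]
        by (auto simp: algebra_simps split: if_splits)
    qed
    \<comment> \<open>Summed over \<open>v\<close>, the derivatives contribute \<open>m\<close> by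
      the Euler identity, and the elements of \<open>T\<close> contribute \<open>q\<close>.\<close>
    have "koszul_bd V (*) var h T =
        (\<Sum>v\<in>V. var v * pderiv_var v (c T)) + (\<Sum>v\<in>V. if v \<in> T then c T else 0)"
      unfolding h_def koszul_bd_sum by (simp add: * sum.distrib)
    also have "(\<Sum>v\<in>V. if v \<in> T then c T else 0) = of_nat q * c T"
      using V T by (simp add: sum.If_cases Int_absorb1)
    also have "(\<Sum>v\<in>V. var v * pderiv_var v (c T)) = of_int m * c T"
      by (rule euler_identity[OF V c[OF T]])
    finally show ?thesis by (simp add: algebra_simps)
  qed
  \<comment> \<open>Characteristic zero enters here: the nonzero integer \<open>m + q\<close> is
    invertible, and \<open>a\<close> is its inverse as a constant polynomial.\<close>
  define a :: "('v, 'k) mpoly" where "a = Poly_Mapping.single 0 (inverse (of_int (m + int q)))"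
  have "a * of_int (m + int q) = 1"
  proof -
    have "a * of_int (m + int q) = Poly_Mapping.single 0 (inverse (of_int (m + int q)) * of_int (m + int q))"
      unfolding a_def by (simp only: single_of_int[symmetric] mult_single add_0)
    also have "inverse (of_int (m + int q)) * of_int (m + int q) = (1 :: 'k)"
      using deg by (intro left_inverse) (simp only: of_int_eq_0_iff not_False_eq_True)
    finally show ?thesis by simp
  qed
  then have "koszul_bd V (*) var (\<lambda>T. a * h T) T = c T" if "T \<subseteq> V" "card T = q" for T
    unfolding koszul_bd_scale h[OF that] by (simp only: mult.assoc[symmetric] mult_1_left)
  moreover have "a * h T \<in> forms V (m - 1)" if T: "T \<subseteq> V" "card T = Suc q" for T
  proof -
    have "a \<in> forms V 0"
      by (rule formsI) (auto simp: a_def lookup_single when_def split: if_splits)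
    moreover have "h T \<in> forms V (m - 1)"
      unfolding h_def
    proof (rule forms_sum)
      fix v assume "v \<in> V"
      show "ext_mult v (\<lambda>T. pderiv_var v (c T)) T \<in> forms V (m - 1)"
        using T V finite_subset[of T V]
        by (auto simp: ext_mult_def intro!: koszul_sign_mult_forms pderiv_var_forms c)
    qed
    ultimately show ?thesis using forms_mult[of a V 0 "h T"] by simp
  qed
  ultimately show ?thesis by (intro exI[of _ "\<lambda>T. a * h T"] conjI allI impI)
qed

section \<open>Graded free modules and their Koszul complexes\<close>

lemma lookup_free_act: "Poly_Mapping.lookup (free_act s u) a = s * Poly_Mapping.lookup u a"
  unfolding free_act_def by (simp add: Poly_Mapping.map.rep_eq when_def)

lemma lookup_koszul_bd:
  "Poly_Mapping.lookup (koszul_bd V free_act y c T) a =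
   koszul_bd V (*) y (\<lambda>T. Poly_Mapping.lookup (c T) a) T"
  by (simp add: koszul_bd_def lookup_sum lookup_free_act)

lemma koszul_bd_bd_free:
  assumes "finite V" "T \<subseteq> V"
  shows "koszul_bd V free_act y (koszul_bd V free_act y c) T = 0"
  by (rule poly_mapping_eqI) (simp add: lookup_koszul_bd koszul_bd_bd[OF assms])

lemma koszul_bd_diff_free:
  "koszul_bd V free_act y (\<lambda>T. c T - c' T) T =
   koszul_bd V free_act y c T - koszul_bd V free_act y c' T"
  by (rule poly_mapping_eqI)
    (simp add: lookup_minus lookup_koszul_bd, simp add: koszul_bd_def right_diff_distrib sum_subtractf)

lemma graded_freeI:
  assumes "\<And>j l. Poly_Mapping.lookup u (j, l) \<noteq> 0 \<Longrightarrow> l < b j \<and> Poly_Mapping.lookup u (j, l) \<in> forms V (m - j)"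
  shows "u \<in> graded_free V b m"
proof -
  have "Poly_Mapping.lookup u (j, l) \<in> forms V (m - j)" for j l
    using assms[of j l] by (cases "Poly_Mapping.lookup u (j, l) = 0") auto
  then show ?thesis unfolding graded_free_def using assms by (auto simp: in_keys_iff)
qed

lemma graded_freeD:
  assumes "u \<in> graded_free V b m"
  shows "Poly_Mapping.lookup u (j, l) \<in> forms V (m - j)" "Poly_Mapping.lookup u (j, l) \<noteq> 0 \<Longrightarrow> l < b j"
  using assms by (auto simp: graded_free_def in_keys_iff)

lemma graded_free_0: "0 \<in> graded_free V b m"
  by (rule graded_freeI) simp

lemma graded_free_add:
  assumes "u \<in> graded_free V b m" "v \<in> graded_free V b m"
  shows "u + v \<in> graded_free V b m"
proof (rule graded_freeI)
  fix j l assume "Poly_Mapping.lookup (u + v) (j, l) \<noteq> 0"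
  then have "Poly_Mapping.lookup u (j, l) \<noteq> 0 \<or> Poly_Mapping.lookup v (j, l) \<noteq> 0"
    by (auto simp: lookup_add)
  then show "l < b j \<and> Poly_Mapping.lookup (u + v) (j, l) \<in> forms V (m - j)"
    using graded_freeD[OF assms(1)] graded_freeD[OF assms(2)] by (auto simp: lookup_add intro: forms_add)
qed

lemma graded_free_uminus: "u \<in> graded_free V b m \<Longrightarrow> - u \<in> graded_free V b m"
  by (rule graded_freeI) (auto dest: graded_freeD intro: forms_uminus)

lemma graded_free_diff:
  assumes "u \<in> graded_free V b m" "v \<in> graded_free V b m"
  shows "u - v \<in> graded_free V b m"
  using graded_free_add[OF assms(1) graded_free_uminus[OF assms(2)]] by simp

lemma graded_free_sum:
  "(\<And>a. a \<in> A \<Longrightarrow> f a \<in> graded_free V b m) \<Longrightarrow> sum f A \<in> graded_free V b m"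
  by (induction A rule: infinite_finite_induct) (auto intro: graded_free_add graded_free_0)

lemma free_act_graded_free:
  assumes "s \<in> forms V k" "u \<in> graded_free V b m"
  shows "free_act s u \<in> graded_free V b (m + k)"
proof (rule graded_freeI)
  fix j l assume "Poly_Mapping.lookup (free_act s u) (j, l) \<noteq> 0"
  then have "Poly_Mapping.lookup u (j, l) \<noteq> 0" by (auto simp: lookup_free_act)
  moreover have "s * Poly_Mapping.lookup u (j, l) \<in> forms V (k + (m - j))"
    by (rule forms_mult[OF assms(1) graded_freeD(1)[OF assms(2)]])
  ultimately show "l < b j \<and> Poly_Mapping.lookup (free_act s u) (j, l) \<in> forms V (m + k - j)"
    using graded_freeD(2)[OF assms(2)] by (simp add: lookup_free_act algebra_simps)
qed

lemma koszul_bd_graded_free: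
  assumes "\<And>g. g \<in> V - T \<Longrightarrow> c (insert g T) \<in> graded_free V b m"
  shows "koszul_bd V free_act var c T \<in> graded_free V b (m + 1)"
  unfolding koszul_bd_def using assms
  by (intro graded_free_sum free_act_graded_free koszul_sign_var_forms) auto

text \<open>A free module is a sum of shifted copies of the ring, so the result for forms applies to
  each coordinate, in degree \<open>m - j\<close>. What remains are the coordinates with
  \<open>m - j + q = 0\<close>, where the homotopy gives nothing and the cycle itself must
  vanish.\<close>

lemma koszul_exact_free:
  fixes c :: "'v::linorder set \<Rightarrow> ('v, 'k::field_char_0) free_elem"
  assumes V: "finite V"
    and c: "\<And>T. T \<subseteq> V \<Longrightarrow> card T = q \<Longrightarrow> c T \<in> graded_free V b m"
    and bd: "\<And>T. T \<subseteq> V \<Longrightarrow> Suc (card T) = q \<Longrightarrow> koszul_bd V free_act var c T = 0"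
    and b: "q = 0 \<Longrightarrow> b m = 0"
  shows "\<exists>e. (\<forall>T. T \<subseteq> V \<longrightarrow> card T = Suc q \<longrightarrow> e T \<in> graded_free V b (m - 1)) \<and>
             (\<forall>T. T \<subseteq> V \<longrightarrow> card T = q \<longrightarrow> koszul_bd V free_act var e T = c T)"
proof -
  have "\<exists>e. (\<forall>T. T \<subseteq> V \<longrightarrow> card T = Suc q \<longrightarrow> e T \<in> forms V (m - fst a - 1)) \<and>
      (\<forall>T. T \<subseteq> V \<longrightarrow> card T = q \<longrightarrow> koszul_bd V (*) var e T = Poly_Mapping.lookup (c T) a)" for a
  proof (cases "m - fst a + int q = 0")
    case False
    show ?thesis
    proof (rule koszul_exact_forms[OF V _ _ False])
      fix T assume "T \<subseteq> V" "card T = q"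
      then show "Poly_Mapping.lookup (c T) a \<in> forms V (m - fst a)"
        by (cases a) (simp add: graded_freeD(1)[OF c])
    next
      fix T assume "T \<subseteq> V" "Suc (card T) = q"
      then show "koszul_bd V (*) var (\<lambda>T. Poly_Mapping.lookup (c T) a) T = 0"
        using bd[of T] lookup_koszul_bd[of V var c T a] by simp
    qed
  next
    case True
    obtain j l where a: "a = (j, l)" by fastforce
    \<comment> \<open>For \<open>q = 0\<close> such a coordinate belongs to a generator of degree
      \<open>m\<close>, which \<open>b\<close> excludes; for \<open>q > 0\<close> its entry would be
      a form of negative degree.\<close>
    have "Poly_Mapping.lookup (c T) a = 0" if T: "T \<subseteq> V" "card T = q" for T
    proof (cases "q = 0")
      case True
      then show ?thesis using graded_freeD(2)[OF c[OF T], of j l] b a \<open>m - fst a + int q = 0\<close> by auto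
    next
      case False
      then have "m - j < 0" using True a by simp
      then show ?thesis
        using formsD(2)[OF graded_freeD(1)[OF c[OF T], of j l]] a
        by (intro poly_mapping_eqI) fastforce
    qed
    then show ?thesis by (intro exI[of _ "\<lambda>_. 0"]) (simp add: koszul_bd_def)
  qed
  then obtain E where E:
    "\<And>a T. T \<subseteq> V \<Longrightarrow> card T = Suc q \<Longrightarrow> E a T \<in> forms V (m - fst a - 1)"
    "\<And>a T. T \<subseteq> V \<Longrightarrow> card T = q \<Longrightarrow> koszul_bd V (*) var (E a) T = Poly_Mapping.lookup (c T) a"
    by metis
  \<comment> \<open>Only coordinates that occur in the chain are solved for, which gives
    \<open>e T\<close> finite support.\<close>
  define A where "A = (\<Union>T\<in>{T. T \<subseteq> V \<and> card T = q}. Poly_Mapping.keys (c T))"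
  have A: "finite A" unfolding A_def using V by auto
  define e where "e T = (\<Sum>a\<in>A. Poly_Mapping.single a (E a T))" for T
  have e: "Poly_Mapping.lookup (e T) a = (if a \<in> A then E a T else 0)" for a T
  proof -
    have "Poly_Mapping.lookup (e T) a = (\<Sum>x\<in>A. if x = a then E a T else 0)"
      unfolding e_def lookup_sum by (rule sum.cong) (auto simp: lookup_single)
    then show ?thesis using A by simp
  qed
  have "e T \<in> graded_free V b (m - 1)" if T: "T \<subseteq> V" "card T = Suc q" for T
  proof (rule graded_freeI)
    fix j l assume "Poly_Mapping.lookup (e T) (j, l) \<noteq> 0"
    then have jl: "(j, l) \<in> A" by (auto simp: e split: if_splits)
    then obtain U where "U \<subseteq> V" "card U = q" "(j, l) \<in> Poly_Mapping.keys (c U)"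
      by (auto simp: A_def)
    then have "l < b j" using graded_freeD(2)[OF c] by (auto simp: in_keys_iff)
    then show "l < b j \<and> Poly_Mapping.lookup (e T) (j, l) \<in> forms V (m - 1 - j)"
      using jl E(1)[OF T, of "(j, l)"] by (simp add: e algebra_simps)
  qed
  moreover have "koszul_bd V free_act var e T = c T" if T: "T \<subseteq> V" "card T = q" for T
  proof (rule poly_mapping_eqI)
    fix a
    show "Poly_Mapping.lookup (koszul_bd V free_act var e T) a = Poly_Mapping.lookup (c T) a"
    proof (cases "a \<in> A")
      case True
      then show ?thesis using E(2)[OF T, of a] by (simp add: lookup_koszul_bd e)
    next
      case False
      then have "Poly_Mapping.lookup (c T) a = 0" using T by (auto simp: A_def in_keys_iff)
      then show ?thesis using False by (simp add: koszul_bd_def lookup_sum lookup_free_act e)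
    qed
  qed
  ultimately show ?thesis by (intro exI[of _ e] conjI allI impI)
qed

section \<open>Chasing Koszul cycles through a resolution\<close>

lemma graded_totalI: "x \<in> M k \<Longrightarrow> x \<in> graded_total M"
  unfolding graded_total_def by (auto intro!: exI[of _ "{k}"] exI[of _ "\<lambda>_. x"])

lemma graded_total_0: "0 \<in> graded_total M"
  unfolding graded_total_def by (auto intro!: exI[of _ "{}"])

context
  fixes V :: "'v set" and actA :: "('v, 'k::comm_ring_1) mpoly \<Rightarrow> 'a::ab_group_add \<Rightarrow> 'a"
    and actB :: "('v, 'k) mpoly \<Rightarrow> 'b::ab_group_add \<Rightarrow> 'b" and A B f
  assumes hom: "graded_hom V actA actB A B f"
begin

lemma graded_hom_add:
  "x \<in> graded_total A \<Longrightarrow> y \<in> graded_total A \<Longrightarrow> f (x + y) = f x + f y"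
  using hom by (simp add: graded_hom_def)

lemma graded_hom_0: "f 0 = 0"
  using graded_hom_add[OF graded_total_0 graded_total_0] by simp

lemma graded_hom_sum_degrees:
  assumes "finite I" "\<And>k. k \<in> I \<Longrightarrow> x k \<in> A k"
  shows "f (\<Sum>k\<in>I. x k) = (\<Sum>k\<in>I. f (x k))"
  using assms
proof (induction I rule: finite_induct)
  case (insert k I)
  have "(\<Sum>k\<in>I. x k) \<in> graded_total A"
    unfolding graded_total_def using insert by blast
  moreover have "x k \<in> graded_total A" using insert graded_totalI by blast
  ultimately show ?case using insert by (simp add: graded_hom_add)
qed (simp add: graded_hom_0)

lemma graded_hom_mem: "x \<in> A m \<Longrightarrow> f x \<in> B m"
  using hom unfolding graded_hom_def by blast

text \<open>
  \<open>\<phi>\<close> is a family of coordinate functions on \<open>B\<close>, each of which lives in a single degree; it makes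
  the sum of the pieces of \<open>B\<close> direct.
\<close>

lemma graded_hom_preimage:
  fixes \<phi> :: "'c \<Rightarrow> 'b \<Rightarrow> 'd::comm_monoid_add"
  assumes \<phi>_0: "\<And>c. \<phi> c 0 = 0" and \<phi>_add: "\<And>c x y. \<phi> c (x + y) = \<phi> c x + \<phi> c y"
    and separating: "\<And>x y. (\<And>c. \<phi> c x = \<phi> c y) \<Longrightarrow> x = y"
    and degree: "\<And>c k x. x \<in> B k \<Longrightarrow> \<phi> c x \<noteq> 0 \<Longrightarrow> k = deg c"
    and 0: "0 \<in> A m" and u: "u \<in> B m" "u \<in> f ` graded_total A"
  shows "\<exists>w\<in>A m. f w = u"
proof -
  from u(2) obtain I x where I: "finite I" "\<And>k. k \<in> I \<Longrightarrow> x k \<in> A k" "u = f (\<Sum>k\<in>I. x k)"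
    by (auto simp: graded_total_def)
  \<comment> \<open>The degree \<open>m\<close> summand of a preimage suffices: the other summands
    map to other degrees and are invisible to the coordinates of degree \<open>m\<close>.\<close>
  define w where "w = (if m \<in> I then x m else 0)"
  have w: "w \<in> A m" using I 0 by (simp add: w_def)
  have \<phi>_sum: "\<phi> c (sum g J) = (\<Sum>j\<in>J. \<phi> c (g j))" for c g and J :: "int set"
    by (induction J rule: infinite_finite_induct) (auto simp: \<phi>_0 \<phi>_add)
  have "\<phi> c (f w) = \<phi> c u" for c
  proof (cases "deg c = m")
    case True
    have "\<phi> c (f (x k)) = (if k = m then \<phi> c (f (x m)) else 0)" if "k \<in> I" for k
      using degree[OF graded_hom_mem[OF I(2)[OF that]], of c] True by auto
    moreover have "f (\<Sum>k\<in>I. x k) = (\<Sum>k\<in>I. f (x k))"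
      by (rule graded_hom_sum_degrees) (use I in auto)
    ultimately have "\<phi> c u = (\<Sum>k\<in>I. if k = m then \<phi> c (f (x m)) else 0)"
      unfolding I(3) by (simp add: \<phi>_sum)
    then show ?thesis using I(1) by (simp add: w_def graded_hom_0 \<phi>_0)
  next
    case False
    then have "\<phi> c (f w) = 0" "\<phi> c u = 0" using degree graded_hom_mem[OF w] u(1) by metis+
    then show ?thesis by simp
  qed
  then show ?thesis using w separating by blast
qed

end

lemma graded_free_hom_koszul_bd:
  fixes V :: "'v::linorder set"
  assumes hom: "graded_hom V free_act act (graded_free V b) B f"
    and c: "\<And>g. g \<in> V - T \<Longrightarrow> c (insert g T) \<in> graded_free V b m"
  shows "f (koszul_bd V free_act var c T) = koszul_bd V act var (\<lambda>T. f (c T)) T"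
proof -
  \<comment> \<open>Additivity of \<open>f\<close> is known only on \<open>graded_total\<close>, so
    the summands are kept in one fixed degree.\<close>
  have sum: "f (sum x A) = (\<Sum>a\<in>A. f (x a))"
    if "\<And>a. a \<in> A \<Longrightarrow> x a \<in> graded_free V b k" for x k and A :: "'v set"
    using that
  proof (induction A rule: infinite_finite_induct)
    case (insert a A)
    have "x a \<in> graded_free V b k" "sum x A \<in> graded_free V b k"
      using insert by (auto intro: graded_free_sum)
    then have "f (x a + sum x A) = f (x a) + f (sum x A)"
      by (intro graded_hom_add[OF hom] graded_totalI[where M = "graded_free V b"])
    then show ?case using insert by simp
  qed (simp_all add: graded_hom_0[OF hom])
  have s: "koszul_sign g T * var g \<in> forms V 1" if "g \<in> V - T" for g
    using that by (intro koszul_sign_var_forms) simp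
  have "f (koszul_bd V free_act var c T) =
      (\<Sum>g\<in>V - T. f (free_act (koszul_sign g T * var g) (c (insert g T))))"
    unfolding koszul_bd_def by (rule sum[of _ _ "m + 1"]) (intro free_act_graded_free s c)
  also have "\<dots> = koszul_bd V act var (\<lambda>T. f (c T)) T"
    unfolding koszul_bd_def
  proof (rule sum.cong[OF refl])
    fix g assume g: "g \<in> V - T"
    show "f (free_act (koszul_sign g T * var g) (c (insert g T))) =
        act (koszul_sign g T * var g) (f (c (insert g T)))"
      using hom forms_polys[OF s[OF g]] graded_totalI[where M = "graded_free V b", OF c[OF g]]
      unfolding graded_hom_def by blast
  qed
  finally show ?thesis .
qed

text \<open>The coordinate functions are the coefficients of a monomial \<open>t\<close> at a basis
  element \<open>a\<close>; such a coefficient lives in degree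
  \<open>fst a + mdeg t\<close>.\<close>

lemma graded_free_hom_preimage:
  assumes hom: "graded_hom V free_act free_act (graded_free V b) (graded_free V b') f"
    and "u \<in> graded_free V b' m" "u \<in> f ` graded_total (graded_free V b)"
  shows "\<exists>w\<in>graded_free V b m. f w = u"
proof (rule graded_hom_preimage[OF hom, where \<phi> = "\<lambda>(a, t) u. Poly_Mapping.lookup (Poly_Mapping.lookup u a) t"
      and deg = "\<lambda>(a, t). fst a + int (mdeg t)"])
  fix c :: "(int \<times> nat) \<times> _" and k x
  assume x: "x \<in> graded_free V b' k" "(case c of (a, t) \<Rightarrow> \<lambda>u. Poly_Mapping.lookup (Poly_Mapping.lookup u a) t) x \<noteq> 0"
  obtain j l t where "c = ((j, l), t)" by (metis surj_pair)
  then show "k = (case c of (a, t) \<Rightarrow> fst a + int (mdeg t))"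
    using x formsD(2)[OF graded_freeD(1)[OF x(1)], of j l t] by simp
next
  fix x y :: "('a, 'b) free_elem"
  assume "\<And>c. (case c of (a, t) \<Rightarrow> \<lambda>u. Poly_Mapping.lookup (Poly_Mapping.lookup u a) t) x =
      (case c of (a, t) \<Rightarrow> \<lambda>u. Poly_Mapping.lookup (Poly_Mapping.lookup u a) t) y"
  then show "x = y" by (intro poly_mapping_eqI) force
qed (use assms in \<open>auto simp: lookup_add graded_free_0\<close>)

text \<open>
  \<open>Z i\<close> is the module of \<open>i\<close>-cycles of the resolution. A cycle of the Koszul complex of the resolved
  module is lifted step by step to \<open>F\<^sub>p\<close>, whose generators do not have degree \<open>p + 2\<close>; there it is a
  boundary, and exactness of the Koszul complexes of the \<open>F\<^sub>i\<close> carries this back.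
\<close>

lemma koszul_zigzag:
  fixes z :: "'v::linorder set \<Rightarrow> ('v, 'k::field_char_0) free_elem"
  assumes V: "finite V"
    and hom: "\<And>i. graded_hom V free_act free_act (graded_free V (b (Suc i))) (graded_free V (b i)) (\<delta> i)"
    and exact: "\<And>i. \<delta> i ` graded_total (graded_free V (b (Suc i))) = Z i"
    and Z: "\<And>i. Z (Suc i) = {u \<in> graded_total (graded_free V (b (Suc i))). \<delta> i u = 0}"
    and b: "b p (int p + 2) = 0"
    and "i + q = p"
    and "\<And>T. T \<subseteq> V \<Longrightarrow> card T = q \<Longrightarrow> z T \<in> graded_free V (b i) (int i + 2)"
    and "\<And>T. T \<subseteq> V \<Longrightarrow> Suc (card T) = q \<Longrightarrow> koszul_bd V free_act var z T \<in> Z i"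
  shows "\<exists>e. (\<forall>T. T \<subseteq> V \<longrightarrow> card T = Suc q \<longrightarrow> e T \<in> graded_free V (b i) (int i + 1)) \<and>
             (\<forall>T. T \<subseteq> V \<longrightarrow> card T = q \<longrightarrow> z T - koszul_bd V free_act var e T \<in> Z i)"
  using assms(6-)
proof (induction q arbitrary: i z)
  case 0
  \<comment> \<open>Here \<open>i = p\<close>. As there are no generators of degree
    \<open>p + 2\<close>, every element of that degree is a combination of variables, that is, a
    Koszul boundary.\<close>
  have "\<exists>e. (\<forall>T. T \<subseteq> V \<longrightarrow> card T = Suc 0 \<longrightarrow> e T \<in> graded_free V (b i) (int i + 2 - 1)) \<and>
      (\<forall>T. T \<subseteq> V \<longrightarrow> card T = 0 \<longrightarrow> koszul_bd V free_act var e T = z T)"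
    by (rule koszul_exact_free[OF V]) (use 0 b in auto)
  moreover have "0 \<in> Z i"
    using exact[of i] graded_hom_0[OF hom, of i] graded_total_0 by (metis imageI)
  ultimately show ?case by (metis (no_types, lifting) diff_self add_diff_eq one_add_one add_diff_cancel)
next
  case (Suc q)
  have fin: "finite T" if "T \<subseteq> V" for T using that V finite_subset by blast
  \<comment> \<open>The boundary of \<open>z\<close> lies in the image of \<open>\<delta> i\<close>.
    Its degree \<open>i + 3\<close> is \<open>Suc i + 2\<close>, which is the normalisation that the
    induction hypothesis expects.\<close>
  have "\<exists>w\<in>graded_free V (b (Suc i)) (int i + 3). \<delta> i w = koszul_bd V free_act var z T"
    if T: "T \<subseteq> V" "card T = q" for T
  proof (rule graded_free_hom_preimage[OF hom])
    have "koszul_bd V free_act var z T \<in> graded_free V (b i) (int i + 2 + 1)"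
      by (rule koszul_bd_graded_free) (use T Suc.prems(2) fin in auto)
    then show "koszul_bd V free_act var z T \<in> graded_free V (b i) (int i + 3)"
      by (simp add: add.commute)
  qed (use T Suc.prems(3) exact in auto)
  then obtain w where w: "\<And>T. T \<subseteq> V \<Longrightarrow> card T = q \<Longrightarrow> w T \<in> graded_free V (b (Suc i)) (int i + 3)"
    "\<And>T. T \<subseteq> V \<Longrightarrow> card T = q \<Longrightarrow> \<delta> i (w T) = koszul_bd V free_act var z T"
    by metis
  \<comment> \<open>The lift is again a cycle modulo \<open>Z\<close>: \<open>\<delta> i\<close>
    carries its boundary to the double boundary of \<open>z\<close>, which is zero.\<close>
  have bdw: "koszul_bd V free_act var w T \<in> Z (Suc i)" if T: "T \<subseteq> V" "Suc (card T) = q" for T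
  proof -
    have w': "w (insert g T) \<in> graded_free V (b (Suc i)) (int i + 3)" if "g \<in> V - T" for g
      using w(1) T that fin by auto
    have "\<delta> i (koszul_bd V free_act var w T) = koszul_bd V free_act var (\<lambda>T. \<delta> i (w T)) T"
      by (rule graded_free_hom_koszul_bd[OF hom]) (rule w')
    also have "\<dots> = koszul_bd V free_act var (koszul_bd V free_act var z) T"
      by (rule koszul_bd_cong, rule w(2)) (use T fin in auto)
    also have "\<dots> = 0" by (rule koszul_bd_bd_free[OF V T(1)])
    finally show ?thesis using Z graded_totalI koszul_bd_graded_free[where c = w, OF w'] by blast
  qed
  obtain e' where e': "\<And>T. T \<subseteq> V \<Longrightarrow> card T = Suc q \<Longrightarrow> e' T \<in> graded_free V (b (Suc i)) (int i + 2)"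
    "\<And>T. T \<subseteq> V \<Longrightarrow> card T = q \<Longrightarrow> w T - koszul_bd V free_act var e' T \<in> Z (Suc i)"
    using Suc.IH[of "Suc i" w] Suc.prems(1) w(1) bdw by (auto simp: algebra_simps)
  \<comment> \<open>Subtracting \<open>\<delta> i (e' T)\<close> turns the cycle modulo
    \<open>Z i\<close> into a genuine Koszul cycle, and changes it only by an element of
    \<open>Z i\<close>.\<close>
  define z' where "z' T = z T - \<delta> i (e' T)" for T
  have "\<exists>e. (\<forall>T. T \<subseteq> V \<longrightarrow> card T = Suc (Suc q) \<longrightarrow> e T \<in> graded_free V (b i) (int i + 2 - 1)) \<and>
      (\<forall>T. T \<subseteq> V \<longrightarrow> card T = Suc q \<longrightarrow> koszul_bd V free_act var e T = z' T)"
  proof (rule koszul_exact_free[OF V])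
    fix T assume "T \<subseteq> V" "card T = Suc q"
    then show "z' T \<in> graded_free V (b i) (int i + 2)"
      unfolding z'_def by (intro graded_free_diff Suc.prems graded_hom_mem[OF hom] e')
  next
    fix T assume "T \<subseteq> V" "Suc (card T) = Suc q"
    then have T: "T \<subseteq> V" "card T = q" by auto
    have e'': "e' (insert g T) \<in> graded_free V (b (Suc i)) (int i + 2)" if "g \<in> V - T" for g
      using e'(1) T that fin by auto
    have *: "w T - koszul_bd V free_act var e' T \<in> graded_total (graded_free V (b (Suc i)))"
      "\<delta> i (w T - koszul_bd V free_act var e' T) = 0"
      using e'(2)[OF T] Z by auto
    have "\<delta> i ((w T - koszul_bd V free_act var e' T) + koszul_bd V free_act var e' T) =
        \<delta> i (koszul_bd V free_act var e' T)"
      using graded_hom_add[OF hom *(1) graded_totalI, OF koszul_bd_graded_free[where c = e', OF e'']] *(2) by simp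
    then have "koszul_bd V free_act var z T = koszul_bd V free_act var (\<lambda>T. \<delta> i (e' T)) T"
      using w(2)[OF T] graded_free_hom_koszul_bd[where c = e', OF hom e''] by simp
    then show "koszul_bd V free_act var z' T = 0"
      unfolding z'_def koszul_bd_diff_free by simp
  qed simp
  then obtain e where e: "\<And>T. T \<subseteq> V \<Longrightarrow> card T = Suc (Suc q) \<Longrightarrow> e T \<in> graded_free V (b i) (int i + 1)"
    "\<And>T. T \<subseteq> V \<Longrightarrow> card T = Suc q \<Longrightarrow> koszul_bd V free_act var e T = z' T"
    by (auto simp: algebra_simps)
  have "z T - koszul_bd V free_act var e T \<in> Z i" if "T \<subseteq> V" "card T = Suc q" for T
    unfolding e(2)[OF that] z'_def using exact graded_totalI[where M = "graded_free V (b (Suc i))", OF e'(1)[OF that]] by auto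
  then show ?case using e(1) by blast
qed

section \<open>Monomial syzygies of the Veronese embedding\<close>

text \<open>The exterior product of the elements \<open>m - l m\<close>, for \<open>m\<close> in the list.\<close>

primrec wedge :: "('v::linorder \<Rightarrow> 'v) \<Rightarrow> 'v list \<Rightarrow> 'v set \<Rightarrow> 'r::comm_ring_1" where
  "wedge l [] = (\<lambda>T. if T = {} then 1 else 0)"
| "wedge l (m # L) = (\<lambda>T. ext_mult m (wedge l L) T - ext_mult (l m) (wedge l L) T)"

text \<open>With all weights equal to 1, each factor \<open>m - l m\<close> is contracted to
  \<open>1 - 1 = 0\<close>, and contraction is an antiderivation.\<close>

lemma koszul_bd_wedge:
  assumes "finite V" "set L \<subseteq> V" "l ` set L \<subseteq> V" "T \<subseteq> V"
  shows "koszul_bd V (*) (\<lambda>_. 1) (wedge l L) T = (0 :: 'r::comm_ring_1)"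
  using assms(2-)
proof (induction L arbitrary: T)
  case (Cons m L)
  have *: "koszul_bd V (*) (\<lambda>_. 1) (ext_mult v (wedge l L)) T = (wedge l L T :: 'r)" if "v \<in> V" for v
  proof -
    have "koszul_bd V (*) (\<lambda>_. 1) (wedge l L) (T - {v}) = (0 :: 'r)"
      using Cons.IH[of "T - {v}"] Cons.prems by auto
    then have "ext_mult v (koszul_bd V (*) (\<lambda>_. 1) (wedge l L)) T = (0 :: 'r)"
      by (simp add: ext_mult_def)
    then show ?thesis
      using koszul_bd_ext_mult[OF assms(1) Cons.prems(3) that, of "\<lambda>_. 1" "wedge l L :: _ \<Rightarrow> 'r"] by simp
  qed
  have "koszul_bd V (*) (\<lambda>_. 1) (wedge l (m # L)) T =
      koszul_bd V (*) (\<lambda>_. 1) (ext_mult m (wedge l L)) T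
      - (koszul_bd V (*) (\<lambda>_. 1) (ext_mult (l m) (wedge l L)) T :: 'r)"
    by (simp add: koszul_bd_def right_diff_distrib sum_subtractf)
  then show ?case using * Cons.prems by simp
qed (simp add: koszul_bd_def)

text \<open>Since no \<open>l m\<close> lies in \<open>set L\<close>, this term of the expanded
  product arises only by choosing \<open>m\<close> in every factor, so its coefficient is a product
  of signs.\<close>

lemma wedge_set_ne_0:
  assumes "distinct L" "l ` set L \<inter> set L = {}"
  shows "wedge l L (set L) \<noteq> (0 :: 'r::field)"
  using assms
proof (induction L)
  case (Cons m L)
  have "koszul_sign m (set L) \<noteq> (0 :: 'r)"
    by (metis koszul_sign_square(1) mult_zero_left zero_neq_one)
  moreover have "insert m (set L) - {m} = set L" "l m \<notin> insert m (set L)"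
    using Cons.prems by auto
  ultimately show ?case using Cons by (auto simp: ext_mult_def)
qed simp

text \<open>A set \<open>T\<close> in the support arises by choosing from each factor either
  \<open>m\<close> or the pure power of the variable \<open>i m\<close>. The second choice raises
  the exponent of \<open>i m\<close> by at most \<open>d - 1\<close>, because \<open>i m\<close>
  divides \<open>m\<close>, and each pure power can be chosen only once.\<close>

lemma wedge_support:
  fixes i :: "'v::linorder monomial \<Rightarrow> 'v"
  assumes d: "d > 0"
    and pure: "\<And>m v. m \<in> set L \<Longrightarrow> m \<noteq> Poly_Mapping.single v d"
    and i: "\<And>m. m \<in> set L \<Longrightarrow> Poly_Mapping.lookup m (i m) > 0"
    and T: "wedge (\<lambda>m. Poly_Mapping.single (i m) d) L T \<noteq> (0 :: 'r::comm_ring_1)"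
  shows "finite T \<and>
    (\<forall>v. Poly_Mapping.lookup (\<Sum>t\<in>T. t) v \<le>
      Poly_Mapping.lookup (sum_list L) v + (if Poly_Mapping.single v d \<in> T then d - 1 else 0)) \<and>
    (\<forall>v. Poly_Mapping.single v d \<in> T \<longrightarrow> v \<in> i ` set L)"
  using pure i T
proof (induction L arbitrary: T)
  case Nil
  then show ?case by (auto split: if_splits)
next
  case (Cons m L)
  let ?w = "wedge (\<lambda>m. Poly_Mapping.single (i m) d) L :: _ \<Rightarrow> 'r"
  let ?l = "Poly_Mapping.single (i m) d"
  have IH: "finite U"
    "\<And>v. Poly_Mapping.lookup (\<Sum>t\<in>U. t) v \<le>
      Poly_Mapping.lookup (sum_list L) v + (if Poly_Mapping.single v d \<in> U then d - 1 else 0)"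
    "\<And>v. Poly_Mapping.single v d \<in> U \<Longrightarrow> v \<in> i ` set L" if "?w U \<noteq> 0" for U
    using Cons.IH[OF _ _ that] Cons.prems(1,2) by auto
  consider "m \<in> T" "?w (T - {m}) \<noteq> 0" | "?l \<in> T" "?w (T - {?l}) \<noteq> 0"
  proof -
    have "v \<in> T \<and> ?w (T - {v}) \<noteq> 0" if "ext_mult v ?w T \<noteq> 0" for v
      using that by (auto simp: ext_mult_def split: if_splits)
    moreover have "ext_mult m ?w T \<noteq> 0 \<or> ext_mult ?l ?w T \<noteq> 0"
      using Cons.prems(3) by force
    ultimately show ?thesis using that by blast
  qed
  then show ?case
  proof cases
    case 1
    define U where "U = T - {m}"
    have U: "T = insert m U" "m \<notin> U" "?w U \<noteq> 0" using 1 by (auto simp: U_def)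
    have *: "Poly_Mapping.single v d \<in> T \<longleftrightarrow> Poly_Mapping.single v d \<in> U" for v
      using Cons.prems(1)[of m v] U(1) by auto
    have "(\<Sum>t\<in>T. t) = m + (\<Sum>t\<in>U. t)" using IH(1)[OF U(3)] U(1,2) by simp
    then show ?thesis
      using IH[OF U(3)] U(1) unfolding * by (auto simp: lookup_add add.assoc intro!: add_left_mono)
  next
    case 2
    define U where "U = T - {?l}"
    have U: "T = insert ?l U" "?l \<notin> U" "?w U \<noteq> 0" using 2 by (auto simp: U_def)
    have *: "Poly_Mapping.single v d \<in> T \<longleftrightarrow> v = i m \<or> Poly_Mapping.single v d \<in> U" for v
    proof -
      have "Poly_Mapping.single v d = ?l \<longleftrightarrow> v = i m"
        using d by (metis lookup_single_eq lookup_single_not_eq less_numeral_extra(3))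
      then show ?thesis using U(1) by auto
    qed
    have sum: "(\<Sum>t\<in>T. t) = ?l + (\<Sum>t\<in>U. t)" using IH(1)[OF U(3)] U(1,2) by simp
    have "Poly_Mapping.lookup (\<Sum>t\<in>T. t) v \<le> Poly_Mapping.lookup (sum_list (m # L)) v +
        (if Poly_Mapping.single v d \<in> T then d - 1 else 0)" for v
    proof (cases "v = i m")
      case True
      \<comment> \<open>The allowance \<open>d - 1\<close> at this variable is still unspent in
        \<open>U\<close>; with the exponent of \<open>m\<close>, at least 1, it pays for the new
        \<open>d\<close>.\<close>
      then have "Poly_Mapping.single v d \<notin> U" using U(2) by simp
      then show ?thesis
        using True IH(2)[OF U(3), of v] Cons.prems(2)[of m] * by (simp add: sum lookup_add)
    next
      case False
      then show ?thesis
        using IH(2)[OF U(3), of v] * by (simp add: sum lookup_add lookup_single_not_eq)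
    qed
    then show ?thesis using IH(1,3)[OF U(3)] U(1) * by auto
  qed
qed

section \<open>Koszul complex and preimages for the Veronese module\<close>

lemma finite_veronese_vars: "finite (veronese_vars n d)"
proof (rule finite_imageD[where f = Poly_Mapping.lookup])
  show "inj_on Poly_Mapping.lookup (veronese_vars n d)"
    by (rule inj_onI) (rule poly_mapping_eqI, simp)
  have "Poly_Mapping.lookup t v \<le> d" if "t \<in> veronese_vars n d" for t v
  proof -
    have "Poly_Mapping.lookup t v \<le> mdeg t"
    proof (cases "v \<in> Poly_Mapping.keys t")
      case True
      then show ?thesis unfolding mdeg_def by (rule member_le_sum) auto
    qed (simp add: in_keys_iff)
    then show ?thesis using that by (simp add: veronese_vars_def)
  qed
  then have "Poly_Mapping.lookup ` veronese_vars n d \<subseteq>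
      {g. \<forall>v. (v \<in> {..n} \<longrightarrow> g v \<in> {..d}) \<and> (v \<notin> {..n} \<longrightarrow> g v = 0)}"
    by (auto simp: veronese_vars_def in_keys_iff subset_iff)
  then show "finite (Poly_Mapping.lookup ` veronese_vars n d)"
    by (rule finite_subset) (rule finite_set_of_finite_funs, auto)
qed

lemma koszul_sign_mult_single:
  "koszul_sign g T * Poly_Mapping.single a 1 =
   (Poly_Mapping.single a (koszul_sign g T) :: 'm::cancel_comm_monoid_add \<Rightarrow>\<^sub>0 'k::comm_ring_1)"
  by (cases "even (card {h \<in> T. h < g})") (simp_all add: koszul_sign_def single_uminus)

lemma single_sum: "Poly_Mapping.single k (sum a A) = (\<Sum>x\<in>A. Poly_Mapping.single k (a x))"
  by (induction A rule: infinite_finite_induct) (simp_all add: single_add)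

text \<open>The variable indexed by the monomial \<open>g\<close> acts on sections as multiplication
  by \<open>g\<close>.\<close>

lemma koszul_bd_veronese_act:
  fixes c :: "nat monomial set \<Rightarrow> (nat, 'k::comm_ring_1) mpoly"
  shows "koszul_bd V veronese_act var c T = koszul_bd V (*) (\<lambda>g. Poly_Mapping.single g 1) c T"
proof -
  have "veronese_hom (Poly_Mapping.single (Poly_Mapping.single g 1) a :: (_, 'k) mpoly) =
      Poly_Mapping.single g a" for g :: "nat monomial" and a
    by (cases "a = 0") (simp_all add: veronese_hom_def mult_single)
  then show ?thesis
    by (simp add: koszul_bd_def veronese_act_def var_def koszul_sign_mult_single)
qed

text \<open>The coordinate functions are the coefficients of monomials \<open>t\<close>; one of
  module degree \<open>k\<close> has polynomial degree \<open>k * d\<close>, so \<open>k\<close> is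
  recovered by division.\<close>

lemma veronese_preimage:
  fixes u :: "(nat, 'k::comm_ring_1) mpoly"
  assumes hom: "graded_hom V free_act veronese_act (graded_free V b) (veronese_module n d) \<epsilon>"
    and d: "d > 0" and u: "u \<in> veronese_module n d m" "u \<in> \<epsilon> ` graded_total (graded_free V b)"
  shows "\<exists>w\<in>graded_free V b m. \<epsilon> w = u"
proof (rule graded_hom_preimage[OF hom, where \<phi> = "\<lambda>t u. Poly_Mapping.lookup u t"
      and deg = "\<lambda>t. int (mdeg t) div int d"])
  fix t k and x :: "(nat, 'k) mpoly"
  assume "x \<in> veronese_module n d k" "Poly_Mapping.lookup x t \<noteq> 0"
  then have "int (mdeg t) = k * int d" using formsD(2) by (simp add: veronese_module_def H0_def)
  then show "k = int (mdeg t) div int d" using d by simp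
qed (use u in \<open>auto simp: lookup_add graded_free_0 intro: poly_mapping_eqI\<close>)

text \<open>
  Dividing \<open>f \<cdot> \<And>\<^sub>m (m - x\<^sub>v\<^sup>d \<cdot> (m / x\<^sub>v\<^sup>d))\<close> out, where \<open>v = i m\<close>, gives a Koszul cycle whose
  coefficients are the monomials \<open>D / \<Prod>T\<close>, with \<open>D\<close> the product of \<open>f\<close> and all its divisors \<open>m\<close> of
  degree \<open>d\<close>.
\<close>

lemma monomial_syzygy:
  fixes f :: "nat monomial" and b :: "nat \<Rightarrow> int \<Rightarrow> nat"
    and \<epsilon> :: "(nat monomial, 'k::field_char_0) free_elem \<Rightarrow> (nat, 'k) mpoly"
  assumes d: "d > 0" and f: "Poly_Mapping.keys f \<subseteq> {..n}" "mdeg f = 2 * d"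
    and M_def: "M = {t. mdeg t = d \<and> (\<exists>u. f = t + u)}"
    and small: "\<And>v. Poly_Mapping.lookup f v < d"
    and critical: "\<And>m. m \<in> M \<Longrightarrow> \<exists>v. Poly_Mapping.lookup m v > 0 \<and> Poly_Mapping.lookup f v \<ge> d - 1"
    and res: "minimal_graded_free_resolution (veronese_vars n d) veronese_act (veronese_module n d) b \<epsilon> \<delta>"
  shows "b (card M) (int (card M) + 2) \<noteq> 0"
proof
  assume b: "b (card M) (int (card M) + 2) = 0"
  define V where "V = veronese_vars n d"
  define F :: "nat \<Rightarrow> int \<Rightarrow> (nat monomial, 'k) free_elem set"
    where "F i = graded_free V (b i)" for i
  have V: "finite V" unfolding V_def by (rule finite_veronese_vars)
  have MV: "M \<subseteq> V"
    using f(1) by (auto simp: M_def V_def veronese_vars_def keys_add_nat)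
  have finM: "finite M" using MV V finite_subset by blast
  obtain L where L: "set L = M" "distinct L" using finite_distinct_list[OF finM] by blast
  have sumL: "sum_list L = (\<Sum>m\<in>M. m)" using L by (metis sum_list_distinct_conv_sum_set map_ident)
  obtain i where i: "\<And>m. m \<in> M \<Longrightarrow> Poly_Mapping.lookup m (i m) > 0"
    "\<And>m. m \<in> M \<Longrightarrow> Poly_Mapping.lookup f (i m) \<ge> d - 1"
    using critical by metis
  define l where "l m = Poly_Mapping.single (i m) d" for m
  \<comment> \<open>Exponents of \<open>f\<close> below \<open>d\<close> keep pure powers out of
    \<open>M\<close>; in particular \<open>l m\<close> is never a member of
    \<open>M\<close>.\<close>
  have pure: "m \<noteq> Poly_Mapping.single v d" if m: "m \<in> M" for m v
  proof
    assume "m = Poly_Mapping.single v d"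
    then have "Poly_Mapping.lookup f v \<ge> d" using m by (auto simp: M_def lookup_add)
    then show False using small[of v] by simp
  qed
  have "l m \<in> V" if "m \<in> M" for m
  proof -
    have "i m \<in> Poly_Mapping.keys m" using i(1)[OF that] by (simp add: in_keys_iff)
    then have "i m \<le> n" using that MV by (auto simp: V_def veronese_vars_def)
    then show ?thesis by (auto simp: V_def veronese_vars_def l_def)
  qed
  then have lV: "l ` set L \<subseteq> V" using L by auto
  define w where "w = (wedge l L :: _ \<Rightarrow> 'k)"
  define D where "D = f + (\<Sum>m\<in>M. m)"
  \<comment> \<open>Subtraction of monomials is truncated, so this says that the product of
    \<open>T\<close> divides \<open>D\<close>. The excess over the product of \<open>M\<close> is at
    most \<open>d - 1\<close>, at critical variables only, and \<open>f\<close> absorbs it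
    there.\<close>
  have D: "D = (\<Sum>t\<in>T. t) + (D - (\<Sum>t\<in>T. t))" if "w T \<noteq> 0" for T
  proof (rule poly_mapping_eqI)
    fix v
    note supp = wedge_support[OF d, of L i T, where 'r='k, folded l_def w_def]
    have 1: "Poly_Mapping.lookup (\<Sum>t\<in>T. t) v \<le>
        Poly_Mapping.lookup (sum_list L) v + (if Poly_Mapping.single v d \<in> T then d - 1 else 0)"
      and 2: "Poly_Mapping.single v d \<in> T \<Longrightarrow> v \<in> i ` M"
      using supp pure i(1) that L(1) by auto
    have "(if Poly_Mapping.single v d \<in> T then d - 1 else 0) \<le> Poly_Mapping.lookup f v"
      using 2 i(2) by auto
    then have "Poly_Mapping.lookup (\<Sum>t\<in>T. t) v \<le> Poly_Mapping.lookup D v"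
      using 1 by (simp add: D_def lookup_add sumL)
    then show "Poly_Mapping.lookup D v = Poly_Mapping.lookup ((\<Sum>t\<in>T. t) + (D - (\<Sum>t\<in>T. t))) v"
      by (simp add: lookup_add lookup_minus)
  qed
  \<comment> \<open>Where truncation could spoil the exponent, \<open>w T\<close> is zero. At
    \<open>T = M\<close> the exponent is \<open>f\<close>.\<close>
  define \<zeta> where "\<zeta> T = Poly_Mapping.single (D - (\<Sum>t\<in>T. t)) (w T)" for T
  have \<zeta>_mem: "\<zeta> T \<in> veronese_module n d 2" if T: "T \<subseteq> V" "card T = card M" for T
    unfolding veronese_module_def H0_def
  proof (rule formsI)
    fix s assume "Poly_Mapping.lookup (\<zeta> T) s \<noteq> 0"
    then have s: "s = D - (\<Sum>t\<in>T. t)" "w T \<noteq> 0"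
      by (auto simp: \<zeta>_def lookup_single when_def split: if_splits)
    have Ds: "D = (\<Sum>t\<in>T. t) + s" using D s by simp
    have deg: "mdeg (\<Sum>t\<in>A. t) = card A * d" if "A \<subseteq> V" for A
      using that by (simp add: mdeg_sum V_def veronese_vars_def subset_iff)
    have "mdeg D = (2 + card M) * d" using f(2) deg[OF MV] by (simp add: D_def algebra_simps)
    then have "mdeg s = 2 * d" using deg[OF T(1)] T(2) Ds by (simp add: algebra_simps)
    moreover have "Poly_Mapping.keys D \<subseteq> {..n}"
    proof -
      have "Poly_Mapping.keys (\<Sum>m\<in>M. m) \<subseteq> (\<Union>m\<in>M. Poly_Mapping.keys m)"
        using finM by (induction M rule: finite_induct) (auto simp: keys_add_nat)
      also have "\<dots> \<subseteq> {..n}" using MV by (auto simp: V_def veronese_vars_def)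
      finally show ?thesis using f(1) by (auto simp: D_def keys_add_nat)
    qed
    ultimately show "Poly_Mapping.keys s \<subseteq> {..n} \<and> int (mdeg s) = 2 * int d"
      using Ds by (auto simp: keys_add_nat)
  qed
  \<comment> \<open>Multiplication by \<open>g\<close> turns \<open>D\<close> divided by the product
    of \<open>insert g T\<close> into \<open>D\<close> divided by the product of \<open>T\<close>.
    All terms then carry the same monomial, and only the weight-one boundary of \<open>w\<close> is
    left.\<close>
  have \<zeta>_cycle: "koszul_bd V veronese_act var \<zeta> T = 0" if T: "T \<subseteq> V" for T
  proof -
    have "koszul_bd V veronese_act var \<zeta> T =
        (\<Sum>g\<in>V - T. Poly_Mapping.single (D - (\<Sum>t\<in>T. t)) (koszul_sign g T * w (insert g T)))"
      unfolding koszul_bd_veronese_act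
      unfolding koszul_bd_def
    proof (rule sum.cong[OF refl])
      fix g assume g: "g \<in> V - T"
      have "g + (D - (\<Sum>t\<in>insert g T. t)) = D - (\<Sum>t\<in>T. t)" if "w (insert g T) \<noteq> 0"
      proof -
        have "(\<Sum>t\<in>insert g T. t) = (\<Sum>t\<in>T. t) + g"
          using g T V finite_subset[of T V] by (simp add: add.commute)
        then have "D = (\<Sum>t\<in>T. t) + (g + (D - (\<Sum>t\<in>insert g T. t)))"
          using D[OF that] by (simp add: add.assoc)
        then show ?thesis by (metis add_diff_cancel_left')
      qed
      then show "koszul_sign g T * Poly_Mapping.single g 1 * \<zeta> (insert g T) =
          Poly_Mapping.single (D - (\<Sum>t\<in>T. t)) (koszul_sign g T * w (insert g T))"
        by (cases "w (insert g T) = 0") (auto simp: koszul_sign_mult_single \<zeta>_def mult_single)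
    qed
    also have "\<dots> = Poly_Mapping.single (D - (\<Sum>t\<in>T. t)) (\<Sum>g\<in>V - T. koszul_sign g T * w (insert g T))"
      by (rule single_sum[symmetric])
    also have "(\<Sum>g\<in>V - T. koszul_sign g T * w (insert g T)) = 0"
      using koszul_bd_wedge[OF V _ lV T, where 'r='k] MV L by (simp add: koszul_bd_def w_def)
    finally show ?thesis by simp
  qed
  have hom\<epsilon>: "graded_hom V free_act veronese_act (F 0) (veronese_module n d) \<epsilon>"
    and hom: "\<And>i. graded_hom V free_act free_act (F (Suc i)) (F i) (\<delta> i)"
    and surj: "\<epsilon> ` graded_total (F 0) = graded_total (veronese_module n d)"
    and exact0: "\<delta> 0 ` graded_total (F (Suc 0)) = {u \<in> graded_total (F 0). \<epsilon> u = 0}"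
    and exact: "\<And>i. \<delta> (Suc i) ` graded_total (F (Suc (Suc i))) =
             {u \<in> graded_total (F (Suc i)). \<delta> i u = 0}"
    using res unfolding minimal_graded_free_resolution_def Let_def V_def[symmetric] F_def[symmetric]
    by auto
  \<comment> \<open>The index of \<open>Z\<close> is that of the module containing it, hence the
    shift: \<open>Z (Suc k)\<close> is the kernel of \<open>\<delta> k\<close>.\<close>
  define Z where "Z i = (case i of 0 \<Rightarrow> {u \<in> graded_total (F 0). \<epsilon> u = 0}
    | Suc k \<Rightarrow> {u \<in> graded_total (F (Suc k)). \<delta> k u = 0})" for i
  have exactZ: "\<delta> i ` graded_total (F (Suc i)) = Z i" for i
    by (cases i) (simp_all add: Z_def exact0 exact)
  have Z_Suc: "Z (Suc i) = {u \<in> graded_total (F (Suc i)). \<delta> i u = 0}" for i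
    by (simp add: Z_def)
  have fin: "finite T" if "T \<subseteq> V" for T using that V finite_subset by blast
  have "\<exists>c\<in>F 0 2. \<epsilon> c = \<zeta> T" if "T \<subseteq> V" "card T = card M" for T
    unfolding F_def using hom\<epsilon> surj \<zeta>_mem[OF that] graded_totalI[where M = "veronese_module n d"] d
    by (intro veronese_preimage) (auto simp: F_def)
  then obtain c where c: "\<And>T. T \<subseteq> V \<Longrightarrow> card T = card M \<Longrightarrow> c T \<in> F 0 2"
    "\<And>T. T \<subseteq> V \<Longrightarrow> card T = card M \<Longrightarrow> \<epsilon> (c T) = \<zeta> T"
    by metis
  have bdc: "koszul_bd V free_act var c T \<in> Z 0" if T: "T \<subseteq> V" "Suc (card T) = card M" for T
  proof -
    have c': "c (insert g T) \<in> graded_free V (b 0) 2" if "g \<in> V - T" for g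
      using c(1) T that fin by (auto simp: F_def)
    have "\<epsilon> (koszul_bd V free_act var c T) = koszul_bd V veronese_act var (\<lambda>T. \<epsilon> (c T)) T"
      by (rule graded_free_hom_koszul_bd[OF hom\<epsilon>[unfolded F_def]]) (rule c')
    also have "\<dots> = koszul_bd V veronese_act var \<zeta> T"
      by (rule koszul_bd_cong, rule c(2)) (use T fin in auto)
    also have "\<dots> = 0" by (rule \<zeta>_cycle[OF T(1)])
    finally show ?thesis
      using graded_totalI[where M = "F 0"] koszul_bd_graded_free[where c = c, OF c']
      by (auto simp: Z_def F_def)
  qed
  \<comment> \<open>The zigzag starts in \<open>F 0\<close> at degree 2 and ends in
    \<open>F (card M)\<close> at degree \<open>card M + 2\<close>, where \<open>b\<close> rules out
    generators.\<close>
  have "\<exists>e. (\<forall>T. T \<subseteq> V \<longrightarrow> card T = Suc (card M) \<longrightarrow> e T \<in> graded_free V (b 0) (int 0 + 1)) \<and>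
      (\<forall>T. T \<subseteq> V \<longrightarrow> card T = card M \<longrightarrow> c T - koszul_bd V free_act var e T \<in> Z 0)"
    by (rule koszul_zigzag[where i = 0 and q = "card M" and p = "card M" and b = b and \<delta> = \<delta>
          and Z = Z, OF V hom[unfolded F_def] exactZ[unfolded F_def] Z_Suc[unfolded F_def] b])
      (use c(1) bdc in \<open>auto simp: F_def\<close>)
  then obtain e where e: "\<And>T. T \<subseteq> V \<Longrightarrow> card T = Suc (card M) \<Longrightarrow> e T \<in> graded_free V (b 0) 1"
    "c M - koszul_bd V free_act var e M \<in> Z 0"
    using MV by auto
  have e': "e (insert g M) \<in> graded_free V (b 0) 1" if "g \<in> V - M" for g
    using e(1) MV that finM by auto
  have bde: "koszul_bd V free_act var e M \<in> graded_total (F 0)"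
    unfolding F_def using graded_totalI koszul_bd_graded_free[where c = e, OF e'] by blast
  have *: "c M - koszul_bd V free_act var e M \<in> graded_total (F 0)"
    "\<epsilon> (c M - koszul_bd V free_act var e M) = 0"
    using e(2) by (auto simp: Z_def)
  have "\<epsilon> ((c M - koszul_bd V free_act var e M) + koszul_bd V free_act var e M) =
      \<epsilon> (koszul_bd V free_act var e M)"
    unfolding graded_hom_add[OF hom\<epsilon> *(1) bde] *(2) by simp
  then have "\<zeta> M = koszul_bd V (*) (\<lambda>g. Poly_Mapping.single g 1) (\<lambda>T. \<epsilon> (e T)) M"
    using c(2)[OF MV refl] graded_free_hom_koszul_bd[where c = e, OF hom\<epsilon>[unfolded F_def] e']
    by (simp add: koszul_bd_veronese_act)
  \<comment> \<open>The boundary at \<open>M\<close> involves only multiples of monomials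
    \<open>g\<close> outside \<open>M\<close>, whereas \<open>M\<close> contains every divisor of
    \<open>f\<close> of degree \<open>d\<close>.\<close>
  also have "Poly_Mapping.lookup \<dots> f = 0"
    unfolding koszul_bd_def lookup_sum koszul_sign_mult_single
  proof (rule sum.neutral, rule ballI, rule lookup_single_mult_eq_0)
    fix g u assume "g \<in> V - M"
    then show "f \<noteq> g + u" by (auto simp: M_def V_def veronese_vars_def)
  qed
  finally have "Poly_Mapping.lookup (\<zeta> M) f = 0" .
  moreover have "Poly_Mapping.lookup (\<zeta> M) f = w M" by (simp add: \<zeta>_def D_def)
  moreover have "l ` set L \<inter> set L = {}" using pure L(1) by (auto simp: l_def)
  then have "w M \<noteq> 0" using wedge_set_ne_0[OF L(2), where 'r='k] L(1) by (simp add: w_def)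
  ultimately show False by simp
qed

section \<open>The theorem\<close>

text \<open>
  The two choices of \<open>f\<close> are \<open>x\<^sub>0 x\<^sub>1 x\<^sub>2 x\<^sub>3\<close>, with 6 quadratic divisors, and
  \<open>x\<^sub>0\<^bsup>d-1\<^esup> x\<^sub>1\<^bsup>d-1\<^esup> x\<^sub>2\<^sup>2\<close>, with \<open>3d - 2\<close> divisors of degree \<open>d\<close>.
\<close>

lemma veronese_satisfies_N_bound:
  fixes f :: "nat monomial"
  assumes "d > 0" "Poly_Mapping.keys f \<subseteq> {..n}" "mdeg f = 2 * d"
    and "M = {t. mdeg t = d \<and> (\<exists>u. f = t + u)}"
    and "\<And>v. Poly_Mapping.lookup f v < d"
    and "\<And>m. m \<in> M \<Longrightarrow> \<exists>v. Poly_Mapping.lookup m v > 0 \<and> Poly_Mapping.lookup f v \<ge> d - 1"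
    and N: "veronese_satisfies_N TYPE('k::field_char_0) n d p"
  shows "p < card M"
proof (rule ccontr)
  assume "\<not> p < card M"
  obtain b \<epsilon> \<delta> where
    res: "minimal_graded_free_resolution (veronese_vars n d) veronese_act
      (veronese_module n d :: int \<Rightarrow> (nat, 'k) mpoly set) b \<epsilon> \<delta>"
    and b: "\<And>j. j \<noteq> 0 \<Longrightarrow> b 0 j = 0"
      "\<And>i j. 1 \<le> i \<Longrightarrow> i \<le> p \<Longrightarrow> j \<noteq> int i + 1 \<Longrightarrow> b i j = 0"
    using N unfolding veronese_satisfies_N_def by blast
  \<comment> \<open>In homological degree 0 this is the condition on \<open>b 0\<close>; otherwise
    it is the condition of property \<open>N\<close> at \<open>card M\<close>, as
    \<open>card M + 2\<close> differs from \<open>card M + 1\<close>.\<close>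
  have "b (card M) (int (card M) + 2) = 0"
    using b(1)[of 2] b(2)[of "card M"] \<open>\<not> p < card M\<close> by (cases "card M = 0") auto
  then show False using monomial_syzygy[OF assms(1-6) res] by simp
qed

lemma veronese_not_N_quadratic:
  assumes n: "n \<ge> 3" and N: "veronese_satisfies_N TYPE('k::field_char_0) n 2 p"
  shows "p \<le> 5"
proof -
  define f :: "nat monomial" where
    "f = Poly_Mapping.single 0 1 + Poly_Mapping.single 1 1 + Poly_Mapping.single 2 1 + Poly_Mapping.single 3 1"
  define M where "M = {t. mdeg t = 2 \<and> (\<exists>u. f = t + u)}"
  have f: "Poly_Mapping.lookup f v = (if v \<in> {0, 1, 2, 3} then 1 else 0)" for v
    by (auto simp: f_def lookup_add lookup_single when_def)
  have M: "Poly_Mapping.lookup t v \<le> (if v \<in> {0, 1, 2, 3} then 1 else 0)"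
    "(\<Sum>v\<in>{0, 1, 2, 3}. Poly_Mapping.lookup t v) = 2" if t: "t \<in> M" for t v
  proof -
    obtain u where u: "f = t + u" using t by (auto simp: M_def)
    show *: "Poly_Mapping.lookup t v \<le> (if v \<in> {0, 1, 2, 3} then 1 else 0)" for v
      using f[of v] by (simp only: u lookup_add)
    have "Poly_Mapping.keys t \<subseteq> {0, 1, 2, 3}"
    proof
      fix v assume "v \<in> Poly_Mapping.keys t"
      then show "v \<in> {0, 1, 2, 3}" using *[of v] by (auto simp: in_keys_iff split: if_splits)
    qed
    then have "mdeg t = (\<Sum>v\<in>{0, 1, 2, 3}. Poly_Mapping.lookup t v)" by (intro mdeg_superset) auto
    then show "(\<Sum>v\<in>{0, 1, 2, 3}. Poly_Mapping.lookup t v) = 2" using t by (simp add: M_def)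
  qed
  have "p < card M"
  proof (rule veronese_satisfies_N_bound[OF _ _ _ M_def _ _ N])
    show "Poly_Mapping.keys f \<subseteq> {..n}" using n by (auto simp: in_keys_iff f split: if_splits)
    show "\<exists>v. Poly_Mapping.lookup m v > 0 \<and> Poly_Mapping.lookup f v \<ge> 2 - 1" if m: "m \<in> M" for m
    proof -
      \<comment> \<open>For \<open>d = 2\<close> the threshold \<open>d - 1\<close> is 1, so each of
        the four variables is critical.\<close>
      have "\<exists>v\<in>{0, 1, 2, 3}. Poly_Mapping.lookup m v \<noteq> 0"
        using M(2)[OF m] by (metis sum.neutral zero_neq_numeral)
      then show ?thesis by (auto simp: f)
    qed
    show "Poly_Mapping.lookup f v < 2" for v by (simp add: f)
  qed (simp_all add: f_def)
  \<comment> \<open>A divisor is determined by its exponents at the first three variables. The six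
    triples are the 0-1 vectors of sum 1 or 2; those of sum 1 are completed by the fourth
    variable.\<close>
  also have "card M \<le> card {(1, 1, 0), (1, 0, 1), (1, 0, 0), (0, 1, 1), (0, 1, 0), (0, 0, 1 :: nat) :: nat \<times> nat \<times> nat}"
  proof (rule card_inj_on_le)
    let ?e = "\<lambda>t :: nat monomial. (Poly_Mapping.lookup t 0, Poly_Mapping.lookup t 1, Poly_Mapping.lookup t 2)"
    show "inj_on ?e M"
    proof (rule inj_onI, rule poly_mapping_eqI)
      fix s t :: "nat monomial" and v :: nat
      assume st: "s \<in> M" "t \<in> M" "?e s = ?e t"
      show "Poly_Mapping.lookup s v = Poly_Mapping.lookup t v"
      proof (cases "v \<in> {0, 1, 2, 3}")
        case True
        then show ?thesis using M(2)[OF st(1)] M(2)[OF st(2)] st(3) by auto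
      next
        case False
        then show ?thesis using M(1)[OF st(1), of v] M(1)[OF st(2), of v] by simp
      qed
    qed
    show "?e ` M \<subseteq> {(1, 1, 0), (1, 0, 1), (1, 0, 0), (0, 1, 1), (0, 1, 0), (0, 0, 1)}"
    proof (rule image_subsetI)
      fix t assume t: "t \<in> M"
      have le: "Poly_Mapping.lookup t v = 0 \<or> Poly_Mapping.lookup t v = 1" for v
        using M(1)[OF t, of v] by (auto split: if_splits)
      show "?e t \<in> {(1, 1, 0), (1, 0, 1), (1, 0, 0), (0, 1, 1), (0, 1, 0), (0, 0, 1)}"
        using le[of 0] le[of 1] le[of 2] le[of 3] M(2)[OF t] by auto
    qed
  qed simp
  finally show ?thesis by simp
qed

lemma veronese_not_N:
  assumes n: "n \<ge> 2" and d: "d \<ge> 3" and N: "veronese_satisfies_N TYPE('k::field_char_0) n d p"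
  shows "p \<le> 3 * d - 3"
proof -
  define f :: "nat monomial" where
    "f = Poly_Mapping.single 0 (d - 1) + Poly_Mapping.single 1 (d - 1) + Poly_Mapping.single 2 2"
  define M where "M = {t. mdeg t = d \<and> (\<exists>u. f = t + u)}"
  have f: "Poly_Mapping.lookup f v = (if v = 0 \<or> v = 1 then d - 1 else if v = 2 then 2 else 0)" for v
    by (auto simp: f_def lookup_add lookup_single when_def)
  have M: "Poly_Mapping.lookup t v \<le> (if v = 0 \<or> v = 1 then d - 1 else if v = 2 then 2 else 0)"
    "Poly_Mapping.lookup t 0 + Poly_Mapping.lookup t 1 + Poly_Mapping.lookup t 2 = d" if t: "t \<in> M" for t v
  proof -
    obtain u where u: "f = t + u" using t by (auto simp: M_def)
    show *: "Poly_Mapping.lookup t v \<le> (if v = 0 \<or> v = 1 then d - 1 else if v = 2 then 2 else 0)" for v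
      using f[of v] by (simp only: u lookup_add)
    have "Poly_Mapping.keys t \<subseteq> {0, 1, 2}"
    proof
      fix v assume "v \<in> Poly_Mapping.keys t"
      then show "v \<in> {0, 1, 2}" using *[of v] by (auto simp: in_keys_iff split: if_splits)
    qed
    then have "mdeg t = (\<Sum>v\<in>{0, 1, 2}. Poly_Mapping.lookup t v)" by (intro mdeg_superset) auto
    then show "Poly_Mapping.lookup t 0 + Poly_Mapping.lookup t 1 + Poly_Mapping.lookup t 2 = d"
      using t by (simp add: M_def)
  qed
  have "p < card M"
  proof (rule veronese_satisfies_N_bound[OF _ _ _ M_def _ _ N])
    show "Poly_Mapping.keys f \<subseteq> {..n}" using n by (auto simp: in_keys_iff f split: if_splits)
    show "\<exists>v. Poly_Mapping.lookup m v > 0 \<and> Poly_Mapping.lookup f v \<ge> d - 1" if m: "m \<in> M" for m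
    proof -
      \<comment> \<open>The third variable contributes at most 2, which is less than
        \<open>d\<close>, so one of the two critical variables divides \<open>m\<close>.\<close>
      have "Poly_Mapping.lookup m 0 > 0 \<or> Poly_Mapping.lookup m 1 > 0"
        using M(2)[OF m] M(1)[OF m, of 2] d by auto
      then show ?thesis using f[of 0] f[of 1] by auto
    qed
    show "Poly_Mapping.lookup f v < d" for v using d by (simp add: f)
  qed (use d in \<open>simp_all add: f_def\<close>)
  \<comment> \<open>Rows are indexed by the exponent of variable 2, entries by that of variable 0.
    The exponent of variable 1 completes the degree to \<open>d\<close> and lies between 0 and
    \<open>d - 1\<close>, which leaves \<open>d - 1\<close>, \<open>d\<close> and
    \<open>d - 1\<close> entries.\<close>
  also have "card M \<le> card ({0} \<times> {1..d - 1} \<union> ({1} \<times> {0..d - 1} \<union> {2 :: nat} \<times> {0..d - 2}))"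
  proof (rule card_inj_on_le)
    let ?e = "\<lambda>t :: nat monomial. (Poly_Mapping.lookup t 2, Poly_Mapping.lookup t 0)"
    show "inj_on ?e M"
    proof (rule inj_onI, rule poly_mapping_eqI)
      fix s t :: "nat monomial" and v :: nat
      assume st: "s \<in> M" "t \<in> M" "?e s = ?e t"
      consider "v = 0" | "v = 1" | "v = 2" | "v > 2" by linarith
      then show "Poly_Mapping.lookup s v = Poly_Mapping.lookup t v"
      proof cases
        case 2
        then show ?thesis using M(2)[OF st(1)] M(2)[OF st(2)] st(3) by simp
      next
        case 4
        then show ?thesis using M(1)[OF st(1), of v] M(1)[OF st(2), of v] by simp
      qed (use st in auto)
    qed
    show "?e ` M \<subseteq> {0} \<times> {1..d - 1} \<union> ({1} \<times> {0..d - 1} \<union> {2} \<times> {0..d - 2})"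
    proof (rule image_subsetI)
      fix t assume t: "t \<in> M"
      have le: "Poly_Mapping.lookup t 0 \<le> d - 1" "Poly_Mapping.lookup t 1 \<le> d - 1"
        "Poly_Mapping.lookup t 2 \<le> 2"
        using M(1)[OF t, of 0] M(1)[OF t, of 1] M(1)[OF t, of 2] by auto
      have "Poly_Mapping.lookup t 2 = 0 \<or> Poly_Mapping.lookup t 2 = 1 \<or> Poly_Mapping.lookup t 2 = 2"
        using le(3) by linarith
      then show "?e t \<in> {0} \<times> {1..d - 1} \<union> ({1} \<times> {0..d - 1} \<union> {2} \<times> {0..d - 2})"
        using le(1,2) M(2)[OF t] d by auto
    qed
  qed simp
  also have "\<dots> = (d - 1) + (d + (d - 1))"
    using d by (subst card_Un_disjoint; auto simp: card_Un_disjoint card_cartesian_product)+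
  finally show ?thesis using d by linarith
qed

theorem mainTheorem1:
  fixes n d p :: nat
  assumes "n \<ge> 2" and "d \<ge> 2"
    and "veronese_satisfies_N TYPE('k::{alg_closed_field, field_char_0}) n d p"
  shows "(n = 2 \<and> d = 2) \<or>
         (n \<ge> 3 \<and> d = 2 \<and> p \<le> 5) \<or>
         (n \<ge> 2 \<and> d \<ge> 3 \<and> p \<le> 3 * d - 3)"
proof (cases "d = 2")
  case True
  then show ?thesis using assms veronese_not_N_quadratic[of n p, where 'k = 'k] by (cases "n = 2") auto
next
  case False
  then show ?thesis using assms veronese_not_N[of n d p, where 'k = 'k] by simp
qed

end
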